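(* For the semi-Markov decision process described in the context, there exist a bounded function $V:\mathcal S\to\mathbb R$ and a constant $g$ such that $$V(x)=\min_{a\in\mathcal A_x}\Big\{c(x;a)+\int_{\mathcal S}V(y)\,\mathcal P_x^a(\mathrm dy)-g\,\tau(x;a)\Big\},\qquad \forall x\in\mathcal S.$$ Moreover, the deterministic stationary policy $\pi^{*(\infty)}$ which in each state $x$ uses an action $\pi^*(x)\in\mathcal A_x$ attaining the minimum on the right-hand side ($\pi^*$ a Borel measurable selector) is optimal for the ratio-average cost criterion, with $$g=\inf_{\pi\in\Pi_{DS}}J(x,\pi)=:J^*(x)\qquad\text{for all }x\in\mathcal S,$$ where $$J(x,\pi)=\limsup_{n\to\infty}\frac{\mathbb E_x^\pi\left[\sum_{k=0}^{n-1}c(X_k;A_k)\right]}{\mathbb E_x^\pi[T_n]}=\limsup_{n\to\infty}\frac{\mathbb E_x^\pi\left[\sum_{k=0}^{n-1}c(X_k;A_k)\right]}{\mathbb E_x^\pi\left[\sum_{k=0}^{n-1}\tau(X_k;A_k)\right]},\qquad \pi\in\Pi_{DS}.$$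
   Context: Model. A single-unit system has condition $2$ (perfect) or $1$ (satisfactory). It spends an $\mathrm{Exp}(\mu_i)$ time in condition $i\in\{1,2\}$. From condition $2$ it moves to condition $1$; when the time in condition $1$ expires the system fails and is instantaneously replaced (corrective maintenance, CM, cost $c_{\mathrm{cm}}$), returning to condition $2$. Scheduled opportunities (SO) for preventive maintenance (PM) occur at times $\tau,2\tau,3\tau,\dots$; unscheduled opportunities (USO) occur according to an independent Poisson process of rate $\lambda$. PM costs $c_{\mathrm{pm}}^{\mathrm{so}}$ at an SO and $c_{\mathrm{pm}}^{\mathrm{uso}}$ at a USO. After PM the system is "as good as new" (condition $2$) with probability $p\in(0,1]$ and "as bad as old" (unchanged) with probability $q=1-p$, independently of everything else. Here $\mu_1,\mu_2,\lambda,\tau>0$, and the PM costs are positive and less than $c_{\mathrm{cm}}$. Semi-Markov decision process. The state space is $$\mathcal S=\{(i,j,t): i\in\{1,2\},\ j\in\{\mathrm{SC},\mathrm{USO}\},\ t\in(0,\tau)\}\cup\{(i,\mathrm{SO},0): i\in\{1,2\}\},$$ where $i$ is the condition, $j$ the type of epoch (SC = the condition is about to change) and $t$ the remaining time until the next SO. Admissible actions $\mathcal A_x$: in $(2,\mathrm{SC},t)$ only "do nothing"; in $(1,\mathrm{SC},t)$ only "perform CM"; in $(i,\mathrm{USO},t)$ and $(i,\mathrm{SO},0)$ either "perform PM" or "do nothing". Immediate costs $c(x;a)$: $0$ for "do nothing", $c_{\mathrm{cm}}$ for CM, $c_{\mathrm{pm}}^{\mathrm{uso}}$ for PM at a USO,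 $c_{\mathrm{pm}}^{\mathrm{so}}$ for PM at an SO. Dynamics: after the action the condition is $k$, where $k=1$ from $(2,\mathrm{SC},t)$; $k=2$ from $(1,\mathrm{SC},t)$; $k=i$ from $(i,\mathrm{USO},t)$ or $(i,\mathrm{SO},0)$ under "do nothing"; and $k=2$ with probability $p$, $k=i$ with probability $1-p$, under "perform PM". Put $r=t$ for SC and USO states and $r=\tau$ for SO states. The next transition time and state then have density $\mu_k e^{-(\lambda+\mu_k)s}$ at $(s,(k,\mathrm{SC},r-s))$ and density $\lambda e^{-(\lambda+\mu_k)s}$ at $(s,(k,\mathrm{USO},r-s))$ for $0<s<r$, and an atom of mass $e^{-(\lambda+\mu_k)r}$ at $(r,(k,\mathrm{SO},0))$. Notation. $X_k$ and $A_k$ are the state and action at the $k$-th transition time $T_k$, with $T_0=0$. $\mathcal P_x^a(\mathrm dy)$ is the law of the next state and $\tau(x;a)$ the mean sojourn time, given current state $x$ and action $a$ (not to be confused with the constant $\tau$). $\Pi_{DS}$ is the class of deterministic stationary policies, i.e. policies given by a Borel measurable map $x\mapsto a\in\mathcal A_x$. $\mathbb E_x^\pi$ is expectation under policy $\pi$ with initial state $x$. *)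

theory Defs
  imports "HOL-Probability.Probability"
begin

datatype cond = Satisfactory | Perfect
datatype epoch = SC | USO | SO
datatype action = DoNothing | PerformPM | PerformCM

type_synonym state = "cond \<times> epoch \<times> real"

record pm_model =
  rate :: "cond \<Rightarrow> real"      \<comment> \<open>\<open>\<mu>\<^sub>1\<close> = \<open>rate Satisfactory\<close>, \<open>\<mu>\<^sub>2\<close> = \<open>rate Perfect\<close>\<close>
  uso_rate :: real            \<comment> \<open>\<open>\<lambda>\<close>\<close>
  period :: real              \<comment> \<open>\<open>\<tau>\<close>\<close>
  pm_success :: real          \<comment> \<open>\<open>p\<close>\<close>
  cost_cm :: real
  cost_pm_so :: real
  cost_pm_uso :: real

definition states :: "pm_model \<Rightarrow> state set" where
  "states M = {(i, j, t) | i j t. (j \<in> {SC, USO} \<and> 0 < t \<and> t < period M) \<or> (j = SO \<and> t = 0)}"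

definition state_space :: "pm_model \<Rightarrow> state measure" where
  "state_space M =
     restrict_space (count_space UNIV \<Otimes>\<^sub>M (count_space UNIV \<Otimes>\<^sub>M borel)) (states M)"

fun admissible :: "state \<Rightarrow> action set" where
  "admissible (Perfect, SC, t) = {DoNothing}"
| "admissible (Satisfactory, SC, t) = {PerformCM}"
| "admissible (i, USO, t) = {PerformPM, DoNothing}"
| "admissible (i, SO, t) = {PerformPM, DoNothing}"

text \<open>In the next two functions only values at admissible actions matter.\<close>

fun cost :: "pm_model \<Rightarrow> state \<Rightarrow> action \<Rightarrow> real" where
  "cost M x DoNothing = 0"
| "cost M x PerformCM = cost_cm M"
| "cost M (i, j, t) PerformPM = (if j = SO then cost_pm_so M else cost_pm_uso M)"

fun post_cond :: "pm_model \<Rightarrow> state \<Rightarrow> action \<Rightarrow> cond pmf" where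
  "post_cond M (Perfect, SC, t) a = return_pmf Satisfactory"
| "post_cond M (Satisfactory, SC, t) a = return_pmf Perfect"
| "post_cond M (i, j, t) PerformPM =
     map_pmf (\<lambda>success. if success then Perfect else i) (bernoulli_pmf (pm_success M))"
| "post_cond M (i, j, t) a = return_pmf i"

fun time_to_SO :: "pm_model \<Rightarrow> state \<Rightarrow> real" where
  "time_to_SO M (i, j, t) = (if j = SO then period M else t)"

text \<open>Joint law of sojourn time and next state when the condition after the action is \<open>k\<close>
  and the next scheduled opportunity is \<open>r\<close> time units away.\<close>

definition sojourn_law :: "pm_model \<Rightarrow> cond \<Rightarrow> real \<Rightarrow> (real \<times> state) measure" where
  "sojourn_law M k r =
     measure_of (space (borel \<Otimes>\<^sub>M state_space M)) (sets (borel \<Otimes>\<^sub>M state_space M))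
       (\<lambda>B. (\<integral>\<^sup>+ s\<in>{0<..<r}.
               ennreal (rate M k * exp (- (uso_rate M + rate M k) * s)) * indicator B (s, k, SC, r - s)
             + ennreal (uso_rate M * exp (- (uso_rate M + rate M k) * s)) * indicator B (s, k, USO, r - s)
             \<partial>lborel)
           + ennreal (exp (- (uso_rate M + rate M k) * r)) * indicator B (r, k, SO, 0))"

definition transition :: "pm_model \<Rightarrow> state \<Rightarrow> action \<Rightarrow> (real \<times> state) measure" where
  "transition M x a =
     measure_pmf (post_cond M x a) \<bind> (\<lambda>k. sojourn_law M k (time_to_SO M x))"

definition next_state_law :: "pm_model \<Rightarrow> state \<Rightarrow> action \<Rightarrow> state measure" where
  "next_state_law M x a = distr (transition M x a) (state_space M) snd"

definition mean_sojourn :: "pm_model \<Rightarrow> state \<Rightarrow> action \<Rightarrow> real" where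
  "mean_sojourn M x a = (\<integral>(s, y). s \<partial>transition M x a)"

definition policies :: "pm_model \<Rightarrow> (state \<Rightarrow> action) set" where
  "policies M = {\<pi> \<in> state_space M \<rightarrow>\<^sub>M count_space UNIV. \<forall>x\<in>states M. \<pi> x \<in> admissible x}"

text \<open>Sample paths are sequences \<open>\<omega>\<close> with \<open>\<omega> k = (T\<^sub>k - T\<^sub>k\<^sub>-\<^sub>1, X\<^sub>k)\<close> and \<open>\<omega> 0 = (0, X\<^sub>0)\<close>.
  Their law is the Ionescu-Tulcea measure of the kernels \<open>path_kernel M \<pi> x\<close>.\<close>

primrec path_kernel ::
  "pm_model \<Rightarrow> (state \<Rightarrow> action) \<Rightarrow> state \<Rightarrow> nat \<Rightarrow> (nat \<Rightarrow> real \<times> state) \<Rightarrow> (real \<times> state) measure"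
where
  "path_kernel M \<pi> x 0 \<omega> = return (borel \<Otimes>\<^sub>M state_space M) (0, x)"
| "path_kernel M \<pi> x (Suc n) \<omega> = transition M (snd (\<omega> n)) (\<pi> (snd (\<omega> n)))"

definition path_law ::
  "pm_model \<Rightarrow> (state \<Rightarrow> action) \<Rightarrow> state \<Rightarrow> (nat \<Rightarrow> real \<times> state) measure" where
  "path_law M \<pi> x =
     projective_family.lim UNIV
       (Ionescu_Tulcea.CI (path_kernel M \<pi> x) (\<lambda>_. borel \<Otimes>\<^sub>M state_space M))
       (\<lambda>_. borel \<Otimes>\<^sub>M state_space M)"

definition state_at :: "nat \<Rightarrow> (nat \<Rightarrow> real \<times> state) \<Rightarrow> state" where
  "state_at k \<omega> = snd (\<omega> k)"

definition transition_time :: "nat \<Rightarrow> (nat \<Rightarrow> real \<times> state) \<Rightarrow> real" where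
  "transition_time n \<omega> = (\<Sum>k=1..n. fst (\<omega> k))"

definition expected_cost :: "pm_model \<Rightarrow> (state \<Rightarrow> action) \<Rightarrow> state \<Rightarrow> nat \<Rightarrow> real" where
  "expected_cost M \<pi> x n =
     (\<integral>\<omega>. (\<Sum>k<n. cost M (state_at k \<omega>) (\<pi> (state_at k \<omega>))) \<partial>path_law M \<pi> x)"

definition expected_time :: "pm_model \<Rightarrow> (state \<Rightarrow> action) \<Rightarrow> state \<Rightarrow> nat \<Rightarrow> real" where
  "expected_time M \<pi> x n = (\<integral>\<omega>. transition_time n \<omega> \<partial>path_law M \<pi> x)"

definition expected_mean_sojourns :: "pm_model \<Rightarrow> (state \<Rightarrow> action) \<Rightarrow> state \<Rightarrow> nat \<Rightarrow> real" where
  "expected_mean_sojourns M \<pi> x n =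
     (\<integral>\<omega>. (\<Sum>k<n. mean_sojourn M (state_at k \<omega>) (\<pi> (state_at k \<omega>))) \<partial>path_law M \<pi> x)"

definition ratio_average_cost :: "pm_model \<Rightarrow> state \<Rightarrow> (state \<Rightarrow> action) \<Rightarrow> ereal" where
  "ratio_average_cost M x \<pi> =
     limsup (\<lambda>n. ereal (expected_cost M \<pi> x n / expected_time M \<pi> x n))"

definition optimality_rhs ::
  "pm_model \<Rightarrow> (state \<Rightarrow> real) \<Rightarrow> real \<Rightarrow> state \<Rightarrow> action \<Rightarrow> real" where
  "optimality_rhs M V g x a =
     cost M x a + (\<integral>y. V y \<partial>next_state_law M x a) - g * mean_sojourn M x a"

definition minimizing_policies ::
  "pm_model \<Rightarrow> (state \<Rightarrow> real) \<Rightarrow> real \<Rightarrow> (state \<Rightarrow> action) set" where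
  "minimizing_policies M V g =
     {\<pi> \<in> policies M. \<forall>x\<in>states M.
        optimality_rhs M V g x (\<pi> x) = Min (optimality_rhs M V g x ` admissible x)}"

end

theory Submission
  imports Defs
begin

text \<open>
Let \<open>w k t\<close> be the relative value of the system just after an action that left it in condition
\<open>k\<close>, with \<open>t\<close> time units to go until the next scheduled opportunity. Conditioning on the next
epoch writes \<open>w k\<close> as an integral, and differentiating that integral turns the optimality equation
into an ordinary differential equation on \<open>[0, \<tau>]\<close>, with a boundary condition at \<open>0\<close> that
describes the decision at a scheduled opportunity and refers to the values at \<open>\<tau>\<close>
(\<open>solves_value_ode\<close>).

The system decouples. The difference \<open>h = w 1 - w 2\<close> satisfies an autonomous equation
\<open>h' = G h - a h\<close> that does not involve \<open>g\<close>, where \<open>a = \<mu>\<^sub>1 + \<mu>\<^sub>2 + \<lambda> p\<close> exceeds the Lipschitz constant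
\<open>\<lambda> p\<close> of \<open>G\<close>; its boundary condition is \<open>h 0 = H (h \<tau>)\<close> with \<open>H\<close> nonexpansive. Because the flow
contracts, the contraction principle yields \<open>h\<close> (\<open>dissipative_ode_boundary_value\<close>). Next,
\<open>w 2\<close> is an integral of \<open>\<mu>\<^sub>2 h - g\<close>, and \<open>g\<close> is the one constant for which it returns to its
starting value after time \<open>\<tau>\<close>. One minimisation over the actions extends \<open>w\<close> from post-action
configurations to states; the resulting \<open>V\<close> is bounded because \<open>w\<close> is continuous on a compact
interval, and \<open>optimality_equation\<close> and \<open>continuation_value\<close> confirm that it solves the
optimality equation.

Optimality is a martingale argument. Under any policy the law of each coordinate of a sample path is the
law of the preceding one pushed through the transition kernel (\<open>distr_path_law_Suc\<close>). Summing
the optimality inequality along the path bounds the expected cost of \<open>n\<close> steps from below by \<open>g\<close> times the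
expected duration, up to twice a bound of \<open>\<bar>V\<bar>\<close>, and for a minimising policy also from above
(\<open>expected_cost_eq\<close>). The bounded error vanishes in the ratio as soon as the
expected duration tends to infinity. Single sojourn times may be arbitrarily short, since a state
may lie just before a scheduled opportunity, but then that opportunity is likely to come next and
is followed by a full period; \<open>so_reserve_drift\<close> makes this quantitative.
\<close>

section \<open>A boundary value problem for a dissipative scalar equation\<close>

text \<open>The flow of \<open>h' = G h - a h\<close> contracts distances over a time \<open>T\<close> since the damping \<open>a\<close> beats the
Lipschitz constant \<open>L\<close>, and \<open>H\<close> does not expand them, so the condition \<open>h 0 = H (h T)\<close> can be met.
The solution is found as a fixed point of the variation of constants formula. The plain formula,
with \<open>H (u T)\<close> as initial value, is no contraction in the supremum norm: at \<open>t = 0\<close> it merely copies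
\<open>H (u T)\<close>. Here \<open>u T\<close> inside \<open>H\<close> is replaced by its own variation of constants expression in
terms of \<open>u 0\<close>, which has the same fixed points and contracts by the factor \<open>\<kappa>\<close> below.\<close>

lemma dissipative_ode_boundary_value:
  fixes G H :: "real \<Rightarrow> real" and a L T :: real
  assumes "0 < T" "0 \<le> L" "L < a"
    and G: "\<And>x y. \<bar>G x - G y\<bar> \<le> L * \<bar>x - y\<bar>"
    and H: "\<And>x y. \<bar>H x - H y\<bar> \<le> \<bar>x - y\<bar>"
  shows "\<exists>h. h 0 = H (h T) \<and>
    (\<forall>t\<in>{0..T}. (h has_real_derivative (G (h t) - a * h t)) (at t within {0..T}))"
proof -
  have "0 < a" using assms by simp
  define K where "K u t = integral {0..t} (\<lambda>s. exp (a * s) * G (u s))" for u t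
  define c where "c u = H (exp (- a * T) * (u 0 + K u T))" for u
  define step where "step u t = exp (- a * t) * (c u + K u t)" for u t
  define clip where "clip t = max 0 (min T t)" for t
  \<comment> \<open>Functions on \<open>[0, T]\<close> are represented by their constant continuations to the real line.\<close>
  define S where "S u = Bcontfun (\<lambda>t. step (apply_bcontfun u) (clip t))" for u :: "real \<Rightarrow>\<^sub>C real"
  define \<kappa> where "\<kappa> = exp (- a * T) + L / a * (1 - exp (- a * T))"

  have cont_G: "continuous_on A G" for A
    by (rule lipschitz_on_continuous_on[of L])
       (use G \<open>0 \<le> L\<close> in \<open>auto simp: lipschitz_on_def dist_real_def\<close>)
  have cont_integrand: "continuous_on A (\<lambda>s. exp (a * s) * G (apply_bcontfun u s))" for A u
    by (intro continuous_on_mult continuous_on_compose2[OF cont_G[of UNIV]] continuous_on_apply_bcontfun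
          continuous_intros) auto
  have clip: "clip t \<in> {0..T}" "t \<in> {0..T} \<Longrightarrow> clip t = t" for t
    using \<open>0 < T\<close> by (auto simp: clip_def)
  have cont_step: "continuous_on {0..T} (step (apply_bcontfun u))" for u
    unfolding step_def K_def
    by (intro continuous_intros indefinite_integral_continuous_1 integrable_continuous_real
          cont_integrand)
  have "(\<lambda>t. step (apply_bcontfun u) (clip t)) \<in> bcontfun" for u
  proof -
    have "continuous_on UNIV clip"
      unfolding clip_def by (intro continuous_intros)
    then have "continuous_on UNIV (\<lambda>t. step (apply_bcontfun u) (clip t))"
      by (rule continuous_on_compose2[OF cont_step]) (use clip in auto)
    moreover have "bounded (step (apply_bcontfun u) ` {0..T})"
      by (intro compact_imp_bounded compact_continuous_image cont_step compact_Icc)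
    then have "bounded (range (\<lambda>t. step (apply_bcontfun u) (clip t)))"
      by (rule bounded_subset) (use clip in auto)
    ultimately show ?thesis by (simp add: bcontfun_def)
  qed
  then have S: "apply_bcontfun (S u) t = step (apply_bcontfun u) (clip t)" for u t
    by (simp add: S_def Bcontfun_inverse)

  have scale: "\<bar>exp r * x - exp r * y\<bar> = exp r * \<bar>x - y\<bar>" for r x y :: real
    by (simp add: abs_mult flip: right_diff_distrib)
  have exp_less: "exp (- a * T) < 1"
    using \<open>0 < a\<close> \<open>0 < T\<close> by simp
  have "L / a < 1" "0 \<le> L / a" using \<open>0 < a\<close> \<open>0 \<le> L\<close> \<open>L < a\<close> by simp_all
  have \<kappa>: "L / a \<le> \<kappa>" "\<kappa> < 1" "0 \<le> \<kappa>"
  proof -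
    have "\<kappa> - L / a = exp (- a * T) * (1 - L / a)" by (simp add: \<kappa>_def algebra_simps)
    then show "L / a \<le> \<kappa>" using \<open>L / a < 1\<close>
      by (metis diff_ge_0_iff_ge exp_ge_zero less_imp_le mult_nonneg_nonneg)
    have "1 - \<kappa> = (1 - exp (- a * T)) * (1 - L / a)" by (simp add: \<kappa>_def algebra_simps)
    then show "\<kappa> < 1" using \<open>L / a < 1\<close> exp_less
      by (metis diff_gt_0_iff_gt mult_pos_pos)
    show "0 \<le> \<kappa>" using \<open>L / a \<le> \<kappa>\<close> \<open>0 \<le> L / a\<close> by linarith
  qed
  have K_diff: "\<bar>K (apply_bcontfun u) t - K (apply_bcontfun v) t\<bar> \<le> dist u v * (L / a * (exp (a * t) - 1))"
    if "0 \<le> t" for u v t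
  proof -
    have *: "((\<lambda>s. dist u v * L * exp (a * s)) has_integral
        dist u v * L / a * exp (a * t) - dist u v * L / a * exp (a * 0)) {0..t}"
      using \<open>0 < a\<close> \<open>0 \<le> t\<close>
      by (intro fundamental_theorem_of_calculus)
         (auto intro!: derivative_eq_intros simp flip: has_real_derivative_iff_has_vector_derivative)
    have "\<bar>exp (a * s) * G (apply_bcontfun u s) - exp (a * s) * G (apply_bcontfun v s)\<bar>
        \<le> dist u v * L * exp (a * s)" for s
    proof -
      have "\<bar>G (apply_bcontfun u s) - G (apply_bcontfun v s)\<bar> \<le> L * dist u v"
        using dist_bounded[of u s v] \<open>0 \<le> L\<close>
        by (intro order_trans[OF G] mult_left_mono) (simp_all add: dist_real_def)
      then have "exp (a * s) * \<bar>G (apply_bcontfun u s) - G (apply_bcontfun v s)\<bar> \<le> exp (a * s) * (L * dist u v)"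
        by simp
      then show ?thesis unfolding scale by (simp add: ac_simps)
    qed
    then have "norm (integral {0..t} (\<lambda>s. exp (a * s) * G (apply_bcontfun u s) - exp (a * s) * G (apply_bcontfun v s)))
        \<le> integral {0..t} (\<lambda>s. dist u v * L * exp (a * s))"
      by (intro integral_norm_bound_integral integrable_diff integrable_continuous_real cont_integrand
           has_integral_integrable[OF *]) auto
    moreover have "K (apply_bcontfun u) t - K (apply_bcontfun v) t =
        integral {0..t} (\<lambda>s. exp (a * s) * G (apply_bcontfun u s) - exp (a * s) * G (apply_bcontfun v s))"
      unfolding K_def by (intro integral_diff[symmetric] integrable_continuous_real cont_integrand)
    ultimately show ?thesis
      using integral_unique[OF *] by (simp add: algebra_simps)
  qed
  have c_diff: "\<bar>c (apply_bcontfun u) - c (apply_bcontfun v)\<bar> \<le> dist u v * \<kappa>" for u v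
  proof -
    have "\<bar>apply_bcontfun u 0 - apply_bcontfun v 0\<bar> \<le> dist u v"
      using dist_bounded[of u 0 v] by (simp add: dist_real_def)
    with K_diff[of T u v] \<open>0 < T\<close>
    have "\<bar>(apply_bcontfun u 0 + K (apply_bcontfun u) T) - (apply_bcontfun v 0 + K (apply_bcontfun v) T)\<bar>
      \<le> dist u v + dist u v * (L / a * (exp (a * T) - 1))" by linarith
    then have "exp (- a * T) * \<bar>(apply_bcontfun u 0 + K (apply_bcontfun u) T) - (apply_bcontfun v 0 + K (apply_bcontfun v) T)\<bar>
      \<le> exp (- a * T) * (dist u v + dist u v * (L / a * (exp (a * T) - 1)))"
      by simp
    also have "\<dots> = dist u v * \<kappa>"
    proof -
      have "E * (D + D * (q * (X - 1))) = D * (E + q * (1 - E))" if "E * X = 1" for D E X q :: real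
        using that by algebra
      from this[OF exp_minus_inverse[of "- a * T"], of "dist u v" "L / a"] show ?thesis
        by (simp only: \<kappa>_def mult_minus_left minus_minus)
    qed
    finally have "\<bar>exp (- a * T) * (apply_bcontfun u 0 + K (apply_bcontfun u) T)
        - exp (- a * T) * (apply_bcontfun v 0 + K (apply_bcontfun v) T)\<bar> \<le> dist u v * \<kappa>"
      by (simp only: scale)
    then show ?thesis unfolding c_def using H order_trans by blast
  qed
  have step_diff: "\<bar>step (apply_bcontfun u) t - step (apply_bcontfun v) t\<bar> \<le> \<kappa> * dist u v"
    if "t \<in> {0..T}" for u v t
  proof -
    have "\<bar>(c (apply_bcontfun u) + K (apply_bcontfun u) t) - (c (apply_bcontfun v) + K (apply_bcontfun v) t)\<bar>
       \<le> dist u v * \<kappa> + dist u v * (L / a * (exp (a * t) - 1))"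
      using c_diff[of u v] K_diff[of t u v] that by auto
    also have "\<dots> \<le> dist u v * \<kappa> + dist u v * (\<kappa> * (exp (a * t) - 1))"
      using \<kappa> that \<open>0 < a\<close> by (intro add_mono mult_left_mono mult_right_mono) auto
    also have "\<dots> = exp (a * t) * (\<kappa> * dist u v)" by (simp add: algebra_simps)
    finally have "exp (- a * t) * \<bar>(c (apply_bcontfun u) + K (apply_bcontfun u) t) - (c (apply_bcontfun v) + K (apply_bcontfun v) t)\<bar>
       \<le> exp (- a * t) * (exp (a * t) * (\<kappa> * dist u v))"
      by simp
    also have "\<dots> = \<kappa> * dist u v" by (simp add: exp_minus)
    finally show ?thesis
      by (simp only: step_def scale)
  qed
  have "\<exists>!u. S u = u"
  proof (rule banach_fix_type[OF \<kappa>(3,2)], intro allI dist_bound)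
    show "dist (apply_bcontfun (S u) t) (apply_bcontfun (S v) t) \<le> \<kappa> * dist u v" for u v t
      using step_diff[OF clip(1)] by (simp add: S dist_real_def)
  qed
  then obtain u where u: "S u = u" by blast
  define h where "h = apply_bcontfun u"
  have h_eq: "h t = step h t" if "t \<in> {0..T}" for t
    using S[of u t] clip(2)[OF that] by (simp add: u h_def)
  have "K h 0 = 0" by (simp add: K_def)
  then have h0: "h 0 = c h" using h_eq[of 0] \<open>0 < T\<close> by (simp add: step_def)
  then have "h 0 = H (h T)"
    using h_eq[of T] \<open>0 < T\<close> by (simp add: step_def c_def)
  moreover have "(h has_real_derivative (G (h t) - a * h t)) (at t within {0..T})"
    if t: "t \<in> {0..T}" for t
  proof -
    have "(K h has_real_derivative (exp (a * t) * G (h t))) (at t within {0..T})"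
      unfolding K_def h_def by (rule integral_has_real_derivative[OF cont_integrand t])
    then have "(step h has_real_derivative
        exp (- a * t) * (exp (a * t) * G (h t)) + (- a * exp (- a * t)) * (c h + K h t)) (at t within {0..T})"
      unfolding step_def by (auto intro!: derivative_eq_intros)
    also have "exp (- a * t) * (exp (a * t) * G (h t)) + (- a * exp (- a * t)) * (c h + K h t) = G (h t) - a * h t"
      using h_eq[OF t] by (simp add: step_def exp_minus)
    finally show ?thesis
      by (rule has_field_derivative_transform_within[OF _ zero_less_one t]) (simp add: h_eq)
  qed
  ultimately show ?thesis by blast
qed

section \<open>Coordinates of an Ionescu-Tulcea measure\<close>

lemma (in Ionescu_Tulcea) distr_lim_initial_segment:
  "distr PF.lim (PiM {0..<n} M) (\<lambda>\<omega>. restrict \<omega> {0..<n}) = C 0 n (\<lambda>_. undefined)"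
proof -
  have "up_to {0..<n} = n"
  proof (rule antisym)
    show "up_to {0..<n} \<le> n" by (simp add: up_to_iff_Ico)
    show "n \<le> up_to {0..<n}"
    proof (rule ccontr)
      assume "\<not> n \<le> up_to {0..<n}"
      then have "up_to {0..<n} \<in> {0..<n}" by simp
      then show False using up_to_less[of "{0..<n}"] by blast
    qed
  qed
  have [simp]: "(\<lambda>_. undefined) \<in> space (PiM {0..<0} M)" by (simp add: space_PiM)
  have "distr (C 0 n (\<lambda>_. undefined)) (PiM {0..<n} M) (\<lambda>f. restrict f {0..<n}) = C 0 n (\<lambda>_. undefined)"
  proof -
    have "distr (C 0 n (\<lambda>_. undefined)) (PiM {0..<n} M) (\<lambda>f. restrict f {0..<n})
       = distr (C 0 n (\<lambda>_. undefined)) (C 0 n (\<lambda>_. undefined)) (\<lambda>f. f)"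
      by (rule distr_cong) (auto simp: sets_C space_C space_PiM PiE_restrict)
    then show ?thesis by (simp add: distr_id2)
  qed
  then show ?thesis
    by (simp add: distr_lim CI_def \<open>up_to {0..<n} = n\<close>)
qed

text \<open>The coordinate \<open>n\<close> depends only on the first \<open>n + 1\<close> coordinates, whose law is a finite iteration
of kernels ending with the kernel \<open>P n\<close>.\<close>

lemma (in Ionescu_Tulcea) distr_lim_coordinate:
  "distr PF.lim (M n) (\<lambda>\<omega>. \<omega> n) = PF.lim \<bind> (\<lambda>\<omega>. P n (restrict \<omega> {0..<n}))"
proof -
  have [simp]: "(\<lambda>_. undefined) \<in> space (PiM {0..<0} M)" by (simp add: space_PiM)
  have [measurable]: "(\<lambda>\<omega>. restrict \<omega> {0..<m}) \<in> PF.lim \<rightarrow>\<^sub>M PiM {0..<m} M" for m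
    by (auto intro!: measurable_restrict simp: measurable_cong_sets[OF PF.sets_lim refl])
  have [measurable]: "(\<lambda>\<omega>. \<omega> n) \<in> PF.lim \<rightarrow>\<^sub>M M n"
    by (simp add: measurable_cong_sets[OF PF.sets_lim refl])
  have K [measurable]: "(\<lambda>\<omega>. P n (restrict \<omega> {0..<n})) \<in> PF.lim \<rightarrow>\<^sub>M subprob_algebra (M n)"
    by (rule measurable_compose[OF _ P]) measurable
  have ne: "space PF.lim \<noteq> {}" by simp
  show ?thesis
  proof (rule measure_eqI)
    show "sets (distr PF.lim (M n) (\<lambda>\<omega>. \<omega> n)) = sets (PF.lim \<bind> (\<lambda>\<omega>. P n (restrict \<omega> {0..<n})))"
      using sets_bind[OF subprob_measurableD(2)[OF K] ne] by simp
    fix A assume "A \<in> sets (distr PF.lim (M n) (\<lambda>\<omega>. \<omega> n))"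
    then have A [measurable]: "A \<in> sets (M n)" by simp
    let ?u = "\<lambda>_::nat. undefined :: 'a"
    have ind [measurable]: "(\<lambda>\<omega>. indicator A (\<omega> n) :: ennreal) \<in> borel_measurable (PiM {0..<Suc n} M)"
      by measurable
    have "emeasure (distr PF.lim (M n) (\<lambda>\<omega>. \<omega> n)) A = (\<integral>\<^sup>+\<omega>. indicator A (\<omega> n) \<partial>PF.lim)"
      by (simp add: nn_integral_distr flip: nn_integral_indicator)
    also have "\<dots> = (\<integral>\<^sup>+\<omega>. indicator A (\<omega> n) \<partial>distr PF.lim (PiM {0..<Suc n} M) (\<lambda>\<omega>. restrict \<omega> {0..<Suc n}))"
      by (subst nn_integral_distr) (auto simp del: restrict_apply simp: restrict_apply')
    also have "\<dots> = (\<integral>\<^sup>+\<omega>. indicator A (\<omega> n) \<partial>(C 0 n ?u \<bind> eP n))"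
      by (simp only: distr_lim_initial_segment C.simps add_0)
    also have "\<dots> = (\<integral>\<^sup>+\<omega>. \<integral>\<^sup>+\<omega>'. indicator A (\<omega>' n) \<partial>eP n \<omega> \<partial>C 0 n ?u)"
      by (rule nn_integral_bind[OF ind]) (simp add: measurable_cong_sets[OF sets_C refl])
    also have "\<dots> = (\<integral>\<^sup>+\<omega>. \<integral>\<^sup>+y. indicator A y \<partial>P n \<omega> \<partial>C 0 n ?u)"
      by (intro nn_integral_cong) (simp add: space_C nn_integral_eP[OF _ ind])
    also have "\<dots> = (\<integral>\<^sup>+\<omega>. \<integral>\<^sup>+y. indicator A y \<partial>P n \<omega> \<partial>distr PF.lim (PiM {0..<n} M) (\<lambda>\<omega>. restrict \<omega> {0..<n}))"
      by (simp only: distr_lim_initial_segment)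
    also have "\<dots> = (\<integral>\<^sup>+\<omega>. \<integral>\<^sup>+y. indicator A y \<partial>P n (restrict \<omega> {0..<n}) \<partial>PF.lim)"
      by (subst nn_integral_distr) measurable
    also have "\<dots> = (\<integral>\<^sup>+\<omega>. emeasure (P n (restrict \<omega> {0..<n})) A \<partial>PF.lim)"
      by (intro nn_integral_cong) (simp add: subprob_measurableD(2)[OF K])
    also have "\<dots> = emeasure (PF.lim \<bind> (\<lambda>\<omega>. P n (restrict \<omega> {0..<n}))) A"
      by (rule emeasure_bind[OF ne K A, symmetric])
    finally show "emeasure (distr PF.lim (M n) (\<lambda>\<omega>. \<omega> n)) A = \<dots>" .
  qed
qed

section \<open>The law of a sojourn\<close>

abbreviation step_space :: "pm_model \<Rightarrow> (real \<times> state) measure" where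
  "step_space M \<equiv> borel \<Otimes>\<^sub>M state_space M"

definition sojourn_rate :: "pm_model \<Rightarrow> cond \<Rightarrow> real" where
  "sojourn_rate M k = uso_rate M + rate M k"

lemma has_integral_exp_decay:
  fixes a r :: real
  assumes "0 < r" "a \<noteq> 0"
  shows "((\<lambda>s. c * exp (- a * s)) has_integral c * (1 - exp (- a * r)) / a) {0<..<r}"
proof -
  have "((\<lambda>s. c * exp (- a * s)) has_integral (- c / a * exp (- a * r)) - (- c / a * exp (- a * 0))) {0..r}"
    using assms by (intro fundamental_theorem_of_calculus)
      (auto intro!: derivative_eq_intros simp flip: has_real_derivative_iff_has_vector_derivative)
  also have "(- c / a * exp (- a * r)) - (- c / a * exp (- a * 0)) = c * (1 - exp (- a * r)) / a"
    using assms by (simp add: field_simps)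
  finally show ?thesis by (simp add: has_integral_Icc_iff_Ioo)
qed

locale pm_system =
  fixes M :: pm_model
  assumes rate_pos: "\<And>i. 0 < rate M i" and uso_rate_pos: "0 < uso_rate M"
    and period_pos: "0 < period M"
    and pm_success_pos: "0 < pm_success M" and pm_success_le_1: "pm_success M \<le> 1"
    and cost_pm_so_pos: "0 < cost_pm_so M" and cost_pm_uso_pos: "0 < cost_pm_uso M"
begin

lemma sojourn_rate_pos: "0 < sojourn_rate M k"
  using rate_pos uso_rate_pos by (simp add: sojourn_rate_def add_pos_pos)

lemma states_measurable [measurable]:
  "states M \<in> sets (count_space UNIV \<Otimes>\<^sub>M (count_space UNIV \<Otimes>\<^sub>M borel))"
proof -
  have "states M = {x \<in> space (count_space UNIV \<Otimes>\<^sub>M (count_space UNIV \<Otimes>\<^sub>M borel)).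
     ((fst (snd x) = SC \<or> fst (snd x) = USO) \<and> 0 < snd (snd x) \<and> snd (snd x) < period M) \<or> (fst (snd x) = SO \<and> snd (snd x) = 0)}"
    by (auto simp: states_def space_pair_measure)
  also have "\<dots> \<in> sets (count_space UNIV \<Otimes>\<^sub>M (count_space UNIV \<Otimes>\<^sub>M borel))"
    by measurable
  finally show ?thesis .
qed

lemma space_state_space [simp]: "space (state_space M) = states M"
  by (simp add: state_space_def space_restrict_space space_pair_measure)

lemma space_step_space [simp]: "space (step_space M) = UNIV \<times> states M"
  by (simp add: space_pair_measure)

lemma state_space_components [measurable]:
  "fst \<in> state_space M \<rightarrow>\<^sub>M count_space UNIV"
  "(\<lambda>x. fst (snd x)) \<in> state_space M \<rightarrow>\<^sub>M count_space UNIV"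
  "(\<lambda>x. snd (snd x)) \<in> state_space M \<rightarrow>\<^sub>M borel"
  unfolding state_space_def by (intro measurable_restrict_space1; measurable)+

text \<open>Events of the state space are events of the ambient product space, where maps such as
\<open>\<lambda>(r, s). (s, k, SC, r - s)\<close> are measurable without any condition on \<open>r\<close> and \<open>s\<close>.\<close>

lemma sets_step_space_subset:
  "sets (step_space M) \<subseteq> sets (borel \<Otimes>\<^sub>M (count_space UNIV \<Otimes>\<^sub>M (count_space UNIV \<Otimes>\<^sub>M borel)))"
  (is "_ \<subseteq> sets ?F")
proof -
  have "A \<times> B \<in> sets ?F" if "A \<in> sets borel" "B \<in> sets (state_space M)" for A B
    using that by (auto simp: state_space_def sets_restrict_space_iff)
  then show ?thesis
    unfolding sets_pair_measure[of borel "state_space M"]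
    by (intro sets.sigma_sets_subset') (auto simp: space_pair_measure)
qed

lemma in_states_iff [simp]:
  "(i, SC, t) \<in> states M \<longleftrightarrow> 0 < t \<and> t < period M"
  "(i, USO, t) \<in> states M \<longleftrightarrow> 0 < t \<and> t < period M"
  "(i, SO, t) \<in> states M \<longleftrightarrow> t = 0"
  by (auto simp: states_def)

text \<open>The possible times until the next scheduled opportunity after an action. For such \<open>r\<close> all
sojourns end in a point of the state space.\<close>

definition admissible_horizon :: "real \<Rightarrow> bool" where
  "admissible_horizon r \<longleftrightarrow> 0 < r \<and> r \<le> period M"

lemma time_to_SO_horizon: "x \<in> states M \<Longrightarrow> admissible_horizon (time_to_SO M x)"
  using period_pos by (cases x) (auto simp: states_def admissible_horizon_def)

text \<open>The expression that defines the law of a sojourn, with a general integrand in place of the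
indicator of an event. That this expression is countably additive, hence a measure, and that it
computes integrals both come from its monotone continuity.\<close>

definition sojourn_functional :: "cond \<Rightarrow> real \<Rightarrow> (real \<times> state \<Rightarrow> ennreal) \<Rightarrow> ennreal" where
  "sojourn_functional k r f =
     (\<integral>\<^sup>+ s\<in>{0<..<r}.
         ennreal (rate M k * exp (- sojourn_rate M k * s)) * f (s, k, SC, r - s)
       + ennreal (uso_rate M * exp (- sojourn_rate M k * s)) * f (s, k, USO, r - s)
       \<partial>lborel)
     + ennreal (exp (- sojourn_rate M k * r)) * f (r, k, SO, 0)"

text \<open>Outside \<open>{0<..<r}\<close> the point \<open>(s, k, j, r - s)\<close> may leave the state space, where nothing is known
about \<open>f\<close>; hence the indicator.\<close>

lemma measurable_along_sojourn:
  assumes f: "f \<in> borel_measurable (step_space M)"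
    and r: "r \<le> period M" and j: "j \<in> {SC, USO}"
  shows "(\<lambda>s. f (s, k, j, r - s) * indicator {0<..<r} s :: ennreal) \<in> borel_measurable borel"
proof -
  have "(\<lambda>s. (s, k, j, r - s)) \<in> restrict_space borel {0<..<r} \<rightarrow>\<^sub>M step_space M"
    unfolding state_space_def
  proof (intro measurable_Pair measurable_restrict_space2)
    show "(\<lambda>s. (k, j, r - s)) \<in> space (restrict_space borel {0<..<r}) \<rightarrow> states M"
      using r j by (auto simp: space_restrict_space states_def)
  qed (intro measurable_restrict_space1; measurable)+
  from measurable_compose[OF this f] show ?thesis
    by (subst (asm) borel_measurable_restrict_space_iff_ennreal) auto
qed

lemma sojourn_functional_SUP:
  assumes f [measurable]: "\<And>i. f i \<in> borel_measurable (step_space M)" and inc: "incseq f"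
    and r: "admissible_horizon r"
  shows "sojourn_functional k r (\<lambda>y. SUP i. f i y) = (SUP i. sojourn_functional k r (f i))"
proof -
  have r': "r \<le> period M" using r by (simp add: admissible_horizon_def)
  note [measurable] = measurable_along_sojourn[OF f r', of SC, simplified]
     measurable_along_sojourn[OF f r', of USO, simplified]
  have mono: "f i y \<le> f j y" if "i \<le> j" for i j y
    using incseqD[OF inc that] by (rule le_funD)
  let ?g = "\<lambda>i s. ennreal (rate M k * exp (- sojourn_rate M k * s)) * (f i (s, k, SC, r - s) * indicator {0<..<r} s)
       + ennreal (uso_rate M * exp (- sojourn_rate M k * s)) * (f i (s, k, USO, r - s) * indicator {0<..<r} s)"
  have g: "sojourn_functional k r h = (\<integral>\<^sup>+ s.
         ennreal (rate M k * exp (- sojourn_rate M k * s)) * (h (s, k, SC, r - s) * indicator {0<..<r} s)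
       + ennreal (uso_rate M * exp (- sojourn_rate M k * s)) * (h (s, k, USO, r - s) * indicator {0<..<r} s) \<partial>lborel)
       + ennreal (exp (- sojourn_rate M k * r)) * h (r, k, SO, 0)" for h
    unfolding sojourn_functional_def by (simp add: distrib_right mult.assoc)
  have inc_g: "incseq ?g"
    by (intro incseq_SucI le_funI add_mono mult_left_mono mult_right_mono mono) auto
  have "sojourn_functional k r (\<lambda>y. SUP i. f i y) = (\<integral>\<^sup>+ s. (SUP i. ?g i s) \<partial>lborel)
     + (SUP i. ennreal (exp (- sojourn_rate M k * r)) * f i (r, k, SO, 0))"
    unfolding g
    by (subst ennreal_SUP_add)
       (auto simp: SUP_mult_left_ennreal SUP_mult_right_ennreal incseq_def
         intro!: mult_left_mono mult_right_mono mono)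
  also have "\<dots> = (SUP i. integral\<^sup>N lborel (?g i))
     + (SUP i. ennreal (exp (- sojourn_rate M k * r)) * f i (r, k, SO, 0))"
    by (subst nn_integral_monotone_convergence_SUP[OF inc_g]) simp_all
  also have "\<dots> = (SUP i. sojourn_functional k r (f i))"
    unfolding g using inc_g
    by (intro ennreal_SUP_add[symmetric])
       (auto simp: incseq_def le_fun_def intro!: mult_left_mono mono nn_integral_mono)
  finally show ?thesis .
qed

lemma sojourn_functional_add:
  assumes f [measurable]: "f \<in> borel_measurable (step_space M)"
    and g [measurable]: "g \<in> borel_measurable (step_space M)"
    and r: "admissible_horizon r"
  shows "sojourn_functional k r (\<lambda>y. f y + g y) = sojourn_functional k r f + sojourn_functional k r g"
proof -
  have r': "r \<le> period M" using r by (simp add: admissible_horizon_def)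
  note [measurable] = measurable_along_sojourn[OF f r', of SC, simplified]
     measurable_along_sojourn[OF f r', of USO, simplified]
     measurable_along_sojourn[OF g r', of SC, simplified]
     measurable_along_sojourn[OF g r', of USO, simplified]
  let ?g = "\<lambda>h s. ennreal (rate M k * exp (- sojourn_rate M k * s)) * (h (s, k, SC, r - s) * indicator {0<..<r} s)
       + ennreal (uso_rate M * exp (- sojourn_rate M k * s)) * (h (s, k, USO, r - s) * indicator {0<..<r} s)"
  have eq: "sojourn_functional k r h = (\<integral>\<^sup>+ s. ?g h s \<partial>lborel)
       + ennreal (exp (- sojourn_rate M k * r)) * h (r, k, SO, 0)" for h
    unfolding sojourn_functional_def by (simp add: distrib_right mult.assoc)
  have "(\<integral>\<^sup>+ s. ?g (\<lambda>y. f y + g y) s \<partial>lborel) = (\<integral>\<^sup>+ s. ?g f s + ?g g s \<partial>lborel)"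
    by (intro nn_integral_cong) (simp add: distrib_left distrib_right ac_simps)
  also have "\<dots> = (\<integral>\<^sup>+ s. ?g f s \<partial>lborel) + (\<integral>\<^sup>+ s. ?g g s \<partial>lborel)"
    by (intro nn_integral_add) simp_all
  finally show ?thesis
    unfolding eq by (simp add: distrib_left ac_simps)
qed

lemma sojourn_functional_suminf:
  assumes f [measurable]: "\<And>i. f i \<in> borel_measurable (step_space M)"
    and r: "admissible_horizon r"
  shows "sojourn_functional k r (\<lambda>y. \<Sum>i. f i y) = (\<Sum>i. sojourn_functional k r (f i))"
proof -
  have "sojourn_functional k r (\<lambda>y. \<Sum>i. f i y) = (SUP n. sojourn_functional k r (\<lambda>y. \<Sum>i<n. f i y))"
    unfolding suminf_eq_SUP
    by (rule sojourn_functional_SUP[OF _ _ r])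
       (auto intro!: incseq_SucI le_funI)
  also have "\<dots> = (SUP n. \<Sum>i<n. sojourn_functional k r (f i))"
  proof (rule arg_cong[where f=Sup], rule image_cong[OF refl])
    show "sojourn_functional k r (\<lambda>y. \<Sum>i<n. f i y) = (\<Sum>i<n. sojourn_functional k r (f i))" for n
    proof (induction n)
      case 0 then show ?case by (simp add: sojourn_functional_def)
    next
      case (Suc n) then show ?case by (simp add: sojourn_functional_add[OF _ _ r])
    qed
  qed
  finally show ?thesis by (simp add: suminf_eq_SUP)
qed

lemma sets_sojourn_law [simp, measurable_cong]: "sets (sojourn_law M k r) = sets (step_space M)"
  unfolding sojourn_law_def by (rule sets.sets_measure_of_eq)

lemma space_sojourn_law [simp]: "space (sojourn_law M k r) = UNIV \<times> states M"
  using sets_eq_imp_space_eq[OF sets_sojourn_law] by simp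

lemma emeasure_sojourn_law:
  assumes r: "admissible_horizon r" and B: "B \<in> sets (step_space M)"
  shows "emeasure (sojourn_law M k r) B = sojourn_functional k r (indicator B)"
proof (rule emeasure_measure_of)
  show "sojourn_law M k r = measure_of (space (step_space M)) (sets (step_space M))
      (\<lambda>B. sojourn_functional k r (indicator B))"
    by (simp only: sojourn_law_def sojourn_functional_def sojourn_rate_def)
  show "positive (sets (sojourn_law M k r)) (\<lambda>B. sojourn_functional k r (indicator B))"
    by (simp add: positive_def sojourn_functional_def)
  show "countably_additive (sets (sojourn_law M k r)) (\<lambda>B. sojourn_functional k r (indicator B))"
  proof (rule countably_additiveI)
    fix F :: "nat \<Rightarrow> _" assume F: "range F \<subseteq> sets (sojourn_law M k r)" "disjoint_family F"
    have [measurable]: "F i \<in> sets (step_space M)" for i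
      using F(1) by auto
    have "(\<Sum>i. sojourn_functional k r (indicator (F i))) = sojourn_functional k r (\<lambda>y. \<Sum>i. indicator (F i) y)"
      by (rule sojourn_functional_suminf[OF _ r, symmetric]) measurable
    also have "(\<lambda>y. \<Sum>i. indicator (F i) y) = (indicator (\<Union>i. F i) :: _ \<Rightarrow> ennreal)"
      using suminf_indicator[OF F(2)] by auto
    finally show "(\<Sum>i. sojourn_functional k r (indicator (F i))) = sojourn_functional k r (indicator (\<Union>i. F i))" .
  qed
qed (simp_all add: B sets.space_closed del: space_step_space)

lemma nn_integral_sojourn_law:
  assumes r: "admissible_horizon r" and f: "f \<in> borel_measurable (step_space M)"
  shows "(\<integral>\<^sup>+y. f y \<partial>sojourn_law M k r) = sojourn_functional k r f"
  using f
proof (induction rule: borel_measurable_induct)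
  case (cong f g)
  have "r \<le> period M" using r by (simp add: admissible_horizon_def)
  then have "sojourn_functional k r f = sojourn_functional k r g"
    unfolding sojourn_functional_def using cong(3)
    by (intro arg_cong2[where f="(+)"] nn_integral_cong)
       (auto simp: indicator_def states_def)
  moreover have "(\<integral>\<^sup>+y. f y \<partial>sojourn_law M k r) = (\<integral>\<^sup>+y. g y \<partial>sojourn_law M k r)"
    using cong(3) by (intro nn_integral_cong) simp
  ultimately show ?case using cong by simp
next
  case (set A) then show ?case by (simp add: emeasure_sojourn_law r)
next
  case (mult u c)
  have "r \<le> period M" using r by (simp add: admissible_horizon_def)
  note [measurable] = measurable_along_sojourn[OF mult(2) this, of SC, simplified]
     measurable_along_sojourn[OF mult(2) this, of USO, simplified]
  have "sojourn_functional k r (\<lambda>x. c * u x) = c * sojourn_functional k r u"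
    unfolding sojourn_functional_def
    by (simp add: distrib_left distrib_right mult.assoc mult.left_commute[of _ c] nn_integral_cmult flip: distrib_left)
  with mult show ?case by (simp add: nn_integral_cmult)
next
  case (add u v)
  then show ?case by (simp add: nn_integral_add sojourn_functional_add r)
next
  case (seq U)
  then show ?case
    by (simp add: image_comp nn_integral_monotone_convergence_SUP sojourn_functional_SUP r)
qed

text \<open>Converts integrals over the law of a sojourn to integrals over a real interval, which are accessible
to the fundamental theorem of calculus.\<close>

lemma nn_integral_sojourn_law_has_integral:
  fixes f :: "real \<times> state \<Rightarrow> real"
  assumes r: "admissible_horizon r" and [measurable]: "f \<in> borel_measurable (step_space M)"
    and nonneg: "\<And>s. 0 < s \<Longrightarrow> s < r \<Longrightarrow> 0 \<le> f (s, k, SC, r - s)"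
      "\<And>s. 0 < s \<Longrightarrow> s < r \<Longrightarrow> 0 \<le> f (s, k, USO, r - s)" "0 \<le> f (r, k, SO, 0)"
    and I: "((\<lambda>s. exp (- sojourn_rate M k * s) *
          (rate M k * f (s, k, SC, r - s) + uso_rate M * f (s, k, USO, r - s))) has_integral I) {0<..<r}"
  shows "(\<integral>\<^sup>+y. ennreal (f y) \<partial>sojourn_law M k r) = ennreal (I + exp (- sojourn_rate M k * r) * f (r, k, SO, 0))"
proof -
  let ?g = "\<lambda>s. exp (- sojourn_rate M k * s) *
          (rate M k * f (s, k, SC, r - s) + uso_rate M * f (s, k, USO, r - s))"
  have pos: "0 \<le> ?g s" if "s \<in> {0<..<r}" for s
    using that nonneg rate_pos[of k] uso_rate_pos by simp
  have "(\<integral>\<^sup>+y. ennreal (f y) \<partial>sojourn_law M k r) = sojourn_functional k r (\<lambda>y. ennreal (f y))"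
    by (rule nn_integral_sojourn_law[OF r]) measurable
  also have "\<dots> = (\<integral>\<^sup>+ s. ennreal (?g s) * indicator {0<..<r} s \<partial>lborel)
     + ennreal (exp (- sojourn_rate M k * r)) * ennreal (f (r, k, SO, 0))"
    unfolding sojourn_functional_def
    using nonneg rate_pos[of k] uso_rate_pos
    by (intro arg_cong2[where f="(+)"] nn_integral_cong refl)
       (auto simp: indicator_def algebra_simps simp flip: ennreal_mult ennreal_plus)
  also have "(\<integral>\<^sup>+ s. ennreal (?g s) * indicator {0<..<r} s \<partial>lborel) = ennreal I"
    by (rule nn_integral_has_integral_lebesgue'[OF pos I])
  also have "0 \<le> I"
    by (rule has_integral_nonneg[OF I pos])
  then have "ennreal I + ennreal (exp (- sojourn_rate M k * r)) * ennreal (f (r, k, SO, 0))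
      = ennreal (I + exp (- sojourn_rate M k * r) * f (r, k, SO, 0))"
    using nonneg(3) by (simp add: ennreal_mult)
  finally show ?thesis .
qed

lemma prob_space_sojourn_law:
  assumes r: "admissible_horizon r"
  shows "prob_space (sojourn_law M k r)"
proof
  have "((\<lambda>s. exp (- sojourn_rate M k * s) * (rate M k * 1 + uso_rate M * 1)) has_integral
        (1 - exp (- sojourn_rate M k * r))) {0<..<r}"
    using has_integral_exp_decay[of r "sojourn_rate M k" "sojourn_rate M k"] r sojourn_rate_pos[of k]
    by (simp add: admissible_horizon_def sojourn_rate_def ac_simps)
  from nn_integral_sojourn_law_has_integral[OF r _ _ _ _ this]
  show "emeasure (sojourn_law M k r) (space (sojourn_law M k r)) = 1"
    by (simp add: nn_integral_const)
qed

text \<open>The nonnegative case applies to \<open>f + B\<close>; the constant \<open>B\<close> integrates to itself because the law is a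
probability measure.\<close>

lemma has_bochner_integral_sojourn_law:
  fixes f :: "real \<times> state \<Rightarrow> real"
  assumes r: "admissible_horizon r" and [measurable]: "f \<in> borel_measurable (step_space M)"
    and bounded: "\<And>y. y \<in> space (step_space M) \<Longrightarrow> \<bar>f y\<bar> \<le> B"
    and I: "((\<lambda>s. exp (- sojourn_rate M k * s) *
          (rate M k * f (s, k, SC, r - s) + uso_rate M * f (s, k, USO, r - s))) has_integral I) {0<..<r}"
  shows "has_bochner_integral (sojourn_law M k r) f (I + exp (- sojourn_rate M k * r) * f (r, k, SO, 0))"
proof -
  interpret prob_space "sojourn_law M k r" by (rule prob_space_sojourn_law[OF r])
  let ?e = "exp (- sojourn_rate M k * r)"
  have nonneg: "0 \<le> f y + B" if "y \<in> UNIV \<times> states M" for y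
    using bounded[of y] that by simp
  have r': "0 < r" "r \<le> period M" using r by (simp_all add: admissible_horizon_def)
  have "((\<lambda>s. B * sojourn_rate M k * exp (- sojourn_rate M k * s)) has_integral B * (1 - ?e)) {0<..<r}"
    using has_integral_exp_decay[of r "sojourn_rate M k" "B * sojourn_rate M k"] r' sojourn_rate_pos[of k]
    by simp
  from has_integral_add[OF I this]
  have I': "((\<lambda>s. exp (- sojourn_rate M k * s) *
          (rate M k * (f (s, k, SC, r - s) + B) + uso_rate M * (f (s, k, USO, r - s) + B)))
         has_integral (I + B * (1 - ?e))) {0<..<r}"
    by (simp add: sojourn_rate_def algebra_simps)
  from nn_integral_sojourn_law_has_integral[OF r _ _ _ _ I']
  have *: "(\<integral>\<^sup>+y. ennreal (f y + B) \<partial>sojourn_law M k r) = ennreal (I + B * (1 - ?e) + ?e * (f (r, k, SO, 0) + B))"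
    using nonneg r' by simp
  have "0 \<le> I + B * (1 - ?e)"
    by (rule has_integral_nonneg[OF I'])
       (use nonneg r' rate_pos[of k] uso_rate_pos in simp)
  then have "0 \<le> I + B * (1 - ?e) + ?e * (f (r, k, SO, 0) + B)"
    using nonneg[of "(r, k, SO, 0)"] by simp
  with * have "has_bochner_integral (sojourn_law M k r) (\<lambda>y. f y + B) (I + B * (1 - ?e) + ?e * (f (r, k, SO, 0) + B))"
    using nonneg by (intro has_bochner_integral_nn_integral) (auto intro!: AE_I2)
  moreover have "has_bochner_integral (sojourn_law M k r) (\<lambda>_. B) B"
    using prob_space by (simp add: has_bochner_integral_iff)
  ultimately have "has_bochner_integral (sojourn_law M k r) (\<lambda>y. f y + B - B)
      (I + B * (1 - ?e) + ?e * (f (r, k, SO, 0) + B) - B)"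
    by (rule has_bochner_integral_diff)
  then show ?thesis by (simp add: algebra_simps)
qed

lemma AE_sojourn_law:
  assumes r: "admissible_horizon r"
  shows "AE y in sojourn_law M k r. 0 < fst y \<and> fst y \<le> period M"
proof -
  let ?N = "{y \<in> space (step_space M). \<not> (0 < fst y \<and> fst y \<le> period M)}"
  have N: "?N \<in> sets (step_space M)"
    by measurable
  have "emeasure (sojourn_law M k r) ?N = 0"
    unfolding emeasure_sojourn_law[OF r N]
    using r by (auto simp: sojourn_functional_def admissible_horizon_def indicator_def
         intro!: nn_integral_zero' AE_I2)
  with N have "?N \<in> null_sets (sojourn_law M k r)"
    by (simp add: null_sets_def del: space_step_space)
  then show ?thesis
    by (rule AE_I') auto
qed

lemma measurable_sojourn_law:
  "sojourn_law M k \<in> restrict_space borel {r. admissible_horizon r} \<rightarrow>\<^sub>M subprob_algebra (step_space M)"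
proof (rule measurable_subprob_algebra)
  fix r assume "r \<in> space (restrict_space borel {r. admissible_horizon r})"
  then have r: "admissible_horizon r" by (simp add: space_restrict_space)
  then show "subprob_space (sojourn_law M k r)"
    by (intro prob_space_imp_subprob_space prob_space_sojourn_law)
next
  fix B assume "B \<in> sets (step_space M)"
  then have B': "B \<in> sets (step_space M)"
    and [measurable]: "B \<in> sets (borel \<Otimes>\<^sub>M (count_space UNIV \<Otimes>\<^sub>M (count_space UNIV \<Otimes>\<^sub>M borel)))"
    using sets_step_space_subset by auto
  have ind: "indicator {0<..<r} s = (if 0 < s \<and> s < r then 1 else 0 :: ennreal)" for r s :: real
    by simp
  have "(\<lambda>r. sojourn_functional k r (indicator B)) \<in> borel_measurable borel"
    unfolding sojourn_functional_def ind by measurable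
  then have "(\<lambda>r. sojourn_functional k r (indicator B)) \<in> borel_measurable (restrict_space borel {r. admissible_horizon r})"
    by (rule measurable_restrict_space1)
  then show "(\<lambda>r. emeasure (sojourn_law M k r) B) \<in> borel_measurable (restrict_space borel {r. admissible_horizon r})"
    by (rule measurable_cong[THEN iffD1, rotated])
       (simp add: emeasure_sojourn_law B' space_restrict_space)
qed simp

end

section \<open>Transitions and sample paths\<close>

context pm_system begin

lemma finite_cond_set [simp]: "finite (A :: cond set)"
  by (rule finite_subset[of _ "{Satisfactory, Perfect}"]) (use cond.exhaust in blast, simp)

lemma sojourn_law_kernel:
  assumes "admissible_horizon r"
  shows "(\<lambda>k. sojourn_law M k r) \<in> measure_pmf q \<rightarrow>\<^sub>M subprob_algebra (step_space M)"
  using prob_space_sojourn_law[OF assms]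
  by (auto simp: measurable_def space_subprob_algebra intro!: prob_space_imp_subprob_space)

lemma sets_transition [measurable_cong]:
  "sets (transition M x a) = sets (step_space M)"
  unfolding transition_def by (rule sets_bind) simp_all

lemma space_transition: "space (transition M x a) = UNIV \<times> states M"
  using sets_eq_imp_space_eq[OF sets_transition] by simp

lemma prob_space_transition:
  assumes "x \<in> states M"
  shows "prob_space (transition M x a)"
  unfolding transition_def
  by (intro prob_space.prob_space_bind[where S="step_space M"] prob_space_measure_pmf AE_I2
      prob_space_sojourn_law sojourn_law_kernel time_to_SO_horizon assms)

lemma AE_transition:
  assumes "x \<in> states M"
  shows "AE y in transition M x a. 0 < fst y \<and> fst y \<le> period M"
proof -
  note r = time_to_SO_horizon[OF assms]
  have "AE k in post_cond M x a. AE y in sojourn_law M k (time_to_SO M x). 0 < fst y \<and> fst y \<le> period M"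
    by (rule AE_I2, rule AE_sojourn_law[OF r])
  then show ?thesis
    unfolding transition_def by (subst AE_bind[OF sojourn_law_kernel[OF r]]) simp_all
qed

lemma integral_transition:
  fixes f :: "real \<times> state \<Rightarrow> real"
  assumes x: "x \<in> states M" and [measurable]: "f \<in> borel_measurable (step_space M)"
    and bounded: "\<And>y. y \<in> space (step_space M) \<Longrightarrow> \<bar>f y\<bar> \<le> B"
  shows "(\<integral>y. f y \<partial>transition M x a) =
    (\<integral>k. (\<integral>y. f y \<partial>sojourn_law M k (time_to_SO M x)) \<partial>post_cond M x a)"
proof -
  note r = time_to_SO_horizon[OF x]
  show ?thesis
    unfolding transition_def
    using prob_space.emeasure_space_1[OF prob_space_sojourn_law[OF r]]
    by (intro integral_bind[where K="step_space M" and B=B and B'=1] sojourn_law_kernel r bounded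
         measure_pmf.finite_measure_axioms AE_I2) simp_all
qed

lemma post_cond_depends_on_type:
  "post_cond M (i, j, t) a = post_cond M (i, j, 0) a"
  by (cases i; cases j; cases a) simp_all

lemma finite_UNIV_epoch: "finite (UNIV :: epoch set)"
  by (rule finite_subset[of _ "{SC, USO, SO}"]) (use epoch.exhaust in blast, simp)

lemma finite_UNIV_action: "finite (UNIV :: action set)"
  by (rule finite_subset[of _ "{DoNothing, PerformPM, PerformCM}"]) (use action.exhaust in blast, simp)

text \<open>Costs and laws of post-action conditions depend on the state only through its first two
components, which range over finite sets, so their measurability follows from that of the policy.\<close>

lemma measurable_of_type_and_action:
  fixes h :: "cond \<Rightarrow> epoch \<Rightarrow> action \<Rightarrow> real"
  assumes [measurable]: "\<pi> \<in> state_space M \<rightarrow>\<^sub>M count_space UNIV"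
  shows "(\<lambda>x. h (fst x) (fst (snd x)) (\<pi> x)) \<in> borel_measurable (state_space M)"
proof -
  have "(\<lambda>x. h i j (\<pi> x)) \<in> borel_measurable (state_space M)" for i j
    by (rule measurable_compose_countable'[where f="\<lambda>a x. h i j a" and g=\<pi> and I=UNIV])
       (simp_all add: countable_finite finite_UNIV_action)
  then have "(\<lambda>x. h i (fst (snd x)) (\<pi> x)) \<in> borel_measurable (state_space M)" for i
    by (intro measurable_compose_countable'[where f="\<lambda>j x. h i j (\<pi> x)" and g="\<lambda>x. fst (snd x)" and I=UNIV])
       (simp_all add: countable_finite finite_UNIV_epoch)
  then show ?thesis
    by (intro measurable_compose_countable'[where f="\<lambda>i x. h i (fst (snd x)) (\<pi> x)" and g=fst and I=UNIV])
       (simp_all add: countable_finite)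
qed

lemma measurable_time_to_SO:
  "time_to_SO M \<in> state_space M \<rightarrow>\<^sub>M restrict_space borel {r. admissible_horizon r}"
proof (rule measurable_restrict_space2)
  have "time_to_SO M = (\<lambda>x. if fst (snd x) = SO then period M else snd (snd x))"
    by auto
  then show "time_to_SO M \<in> borel_measurable (state_space M)"
    by simp
qed (use time_to_SO_horizon in simp)

lemma measurable_transition:
  assumes \<pi> [measurable]: "\<pi> \<in> state_space M \<rightarrow>\<^sub>M count_space UNIV"
  shows "(\<lambda>x. transition M x (\<pi> x)) \<in> state_space M \<rightarrow>\<^sub>M subprob_algebra (step_space M)"
proof (rule measurable_subprob_algebra)
  show "subprob_space (transition M x (\<pi> x))" if "x \<in> space (state_space M)" for x
    using that by (intro prob_space_imp_subprob_space prob_space_transition) simp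
next
  fix B assume B [measurable]: "B \<in> sets (step_space M)"
  have [measurable]: "(\<lambda>x. emeasure (sojourn_law M k (time_to_SO M x)) B) \<in> borel_measurable (state_space M)" for k
    by (intro measurable_compose[OF measurable_time_to_SO]
         measurable_compose[OF measurable_sojourn_law measurable_emeasure_subprob_algebra] B)
  have [measurable]: "(\<lambda>x. pmf (post_cond M (fst x, fst (snd x), 0) (\<pi> x)) k) \<in> borel_measurable (state_space M)" for k
    by (rule measurable_of_type_and_action[OF \<pi>])
  have "(\<lambda>x. \<Sum>k\<in>UNIV. ennreal (pmf (post_cond M (fst x, fst (snd x), 0) (\<pi> x)) k)
       * emeasure (sojourn_law M k (time_to_SO M x)) B) \<in> borel_measurable (state_space M)"
    by measurable
  moreover have "emeasure (transition M x (\<pi> x)) B =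
      (\<Sum>k\<in>UNIV. ennreal (pmf (post_cond M (fst x, fst (snd x), 0) (\<pi> x)) k)
       * emeasure (sojourn_law M k (time_to_SO M x)) B)" if "x \<in> space (state_space M)" for x
  proof -
    have "emeasure (transition M x (\<pi> x)) B =
        (\<integral>\<^sup>+k. emeasure (sojourn_law M k (time_to_SO M x)) B \<partial>post_cond M x (\<pi> x))"
      unfolding transition_def using that
      by (intro emeasure_bind[OF _ sojourn_law_kernel B] time_to_SO_horizon) simp_all
    also have "\<dots> = (\<Sum>k\<in>UNIV. emeasure (sojourn_law M k (time_to_SO M x)) B * ennreal (pmf (post_cond M x (\<pi> x)) k))"
      by (rule nn_integral_measure_pmf_support) auto
    also have "post_cond M x (\<pi> x) = post_cond M (fst x, fst (snd x), 0) (\<pi> x)"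
      by (metis post_cond_depends_on_type prod.collapse)
    finally show ?thesis by (simp add: mult.commute)
  qed
  ultimately show "(\<lambda>x. emeasure (transition M x (\<pi> x)) B) \<in> borel_measurable (state_space M)"
    by (subst measurable_cong) auto
qed (rule sets_transition)

lemma integral_next_state_law:
  assumes "V \<in> borel_measurable (state_space M)"
  shows "(\<integral>y. V y \<partial>next_state_law M x a) = (\<integral>y. V (snd y) \<partial>transition M x a :: real)"
  unfolding next_state_law_def
  by (rule integral_distr[OF _ assms]) (simp add: measurable_cong_sets[OF sets_transition refl])

lemma abs_integral_transition_le:
  fixes f :: "real \<times> state \<Rightarrow> real"
  assumes x: "x \<in> states M" and [measurable]: "f \<in> borel_measurable (step_space M)"
    and "0 \<le> B" and bounded: "AE y in transition M x a. \<bar>f y\<bar> \<le> B"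
  shows "\<bar>\<integral>y. f y \<partial>transition M x a\<bar> \<le> B"
proof -
  interpret prob_space "transition M x a" by (rule prob_space_transition[OF x])
  have "integrable (transition M x a) f"
    by (rule integrable_const_bound[where B=B])
       (use bounded in \<open>simp_all add: measurable_cong_sets[OF sets_transition refl]\<close>)
  then have "\<bar>\<integral>y. f y \<partial>transition M x a\<bar> \<le> (\<integral>y. \<bar>f y\<bar> \<partial>transition M x a)"
    by simp
  also have "\<dots> \<le> (\<integral>y. B \<partial>transition M x a)"
    by (rule integral_mono_AE) (use \<open>integrable _ f\<close> bounded in simp_all)
  finally show ?thesis by (simp add: prob_space)
qed

end

locale pm_system_policy = pm_system +
  fixes \<pi> :: "state \<Rightarrow> action" and x0 :: state
  assumes policy: "\<pi> \<in> policies M" and initial_state: "x0 \<in> states M"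
begin

lemma policy_measurable [measurable]: "\<pi> \<in> state_space M \<rightarrow>\<^sub>M count_space UNIV"
  using policy by (simp add: policies_def)

lemma Ionescu_Tulcea_path_kernel: "Ionescu_Tulcea (path_kernel M \<pi> x0) (\<lambda>_. step_space M)"
proof (rule Ionescu_Tulcea.intro)
  show "path_kernel M \<pi> x0 i \<in> PiM {0..<i} (\<lambda>_. step_space M) \<rightarrow>\<^sub>M subprob_algebra (step_space M)" for i
  proof (cases i)
    case 0
    have "(\<lambda>_. return (step_space M) (0, x0)) \<in> PiM {0..<i} (\<lambda>_. step_space M) \<rightarrow>\<^sub>M subprob_algebra (step_space M)"
      by (rule measurable_const) (use initial_state in \<open>simp add: space_subprob_algebra subprob_space_return\<close>)
    moreover have "path_kernel M \<pi> x0 0 = (\<lambda>_. return (step_space M) (0, x0))"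
      by (rule ext) simp
    ultimately show ?thesis using 0 by simp
  next
    case (Suc n)
    have "(\<lambda>\<omega>. snd (\<omega> n)) \<in> PiM {0..<i} (\<lambda>_. step_space M) \<rightarrow>\<^sub>M state_space M"
      by (rule measurable_compose[where f="\<lambda>\<omega>. \<omega> n" and g=snd and N="step_space M", OF _ measurable_snd])
         (use Suc in \<open>intro measurable_component_singleton; simp\<close>)
    note measurable_compose[OF this measurable_transition[OF policy_measurable]]
    moreover have "path_kernel M \<pi> x0 (Suc n) = (\<lambda>\<omega>. transition M (snd (\<omega> n)) (\<pi> (snd (\<omega> n))))"
      by (rule ext) simp
    ultimately show ?thesis using Suc by simp
  qed
  show "prob_space (path_kernel M \<pi> x0 i \<omega>)" if "\<omega> \<in> space (PiM {0..<i} (\<lambda>_. step_space M))" for i \<omega>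
  proof (cases i)
    case 0 then show ?thesis using initial_state by (simp add: prob_space_return)
  next
    case (Suc n)
    then have "\<omega> n \<in> UNIV \<times> states M"
      using that by (auto simp: space_PiM PiE_iff)
    then show ?thesis unfolding Suc
      by (auto intro!: prob_space_transition)
  qed
qed

sublocale IT: Ionescu_Tulcea "path_kernel M \<pi> x0" "\<lambda>_. step_space M"
  by (rule Ionescu_Tulcea_path_kernel)

lemma path_law_eq: "path_law M \<pi> x0 = IT.PF.lim"
  by (simp add: path_law_def)

sublocale path: prob_space "path_law M \<pi> x0"
proof -
  have "prob_space (distr IT.PF.lim (PiM {0..<0} (\<lambda>_. step_space M)) (\<lambda>\<omega>. restrict \<omega> {0..<0}))"
    unfolding IT.distr_lim_initial_segment by (rule IT.prob_space_C) (simp add: space_PiM)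
  moreover have "(\<lambda>\<omega>. restrict \<omega> {0..<0}) \<in> IT.PF.lim \<rightarrow>\<^sub>M PiM {0..<0} (\<lambda>_. step_space M)"
    by (intro measurable_restrict) simp
  ultimately show "prob_space (path_law M \<pi> x0)"
    unfolding path_law_eq by (rule prob_space_distrD[rotated])
qed

lemma sets_path_law [simp, measurable_cong]: "sets (path_law M \<pi> x0) = sets (PiM UNIV (\<lambda>_. step_space M))"
  by (simp add: path_law_eq)

lemma space_path_law [simp]: "space (path_law M \<pi> x0) = space (PiM UNIV (\<lambda>_. step_space M))"
  by (simp add: path_law_eq)

lemma measurable_state_at [measurable]: "state_at n \<in> path_law M \<pi> x0 \<rightarrow>\<^sub>M state_space M"
  unfolding state_at_def by measurable

lemma state_at_states: "\<omega> \<in> space (path_law M \<pi> x0) \<Longrightarrow> state_at n \<omega> \<in> states M"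
  using measurable_space[OF measurable_state_at] by simp

lemma distr_path_law_0: "distr (path_law M \<pi> x0) (step_space M) (\<lambda>\<omega>. \<omega> 0) = return (step_space M) (0, x0)"
  unfolding path_law_eq IT.distr_lim_coordinate path_kernel.simps
  using path.prob_space_axioms initial_state
  by (intro bind_const' subprob_space_return) (simp_all add: path_law_eq)

lemma transition_kernel:
  "(\<lambda>\<omega>. transition M (state_at n \<omega>) (\<pi> (state_at n \<omega>))) \<in> path_law M \<pi> x0 \<rightarrow>\<^sub>M subprob_algebra (step_space M)"
  by (rule measurable_compose[OF measurable_state_at measurable_transition[OF policy_measurable]])

text \<open>The Markov property in the form needed here: one more step of the path is one application of the
transition kernel.\<close>

lemma distr_path_law_Suc:
  "distr (path_law M \<pi> x0) (step_space M) (\<lambda>\<omega>. \<omega> (Suc n)) =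
     path_law M \<pi> x0 \<bind> (\<lambda>\<omega>. transition M (state_at n \<omega>) (\<pi> (state_at n \<omega>)))"
  unfolding path_law_eq IT.distr_lim_coordinate path_kernel.simps state_at_def by simp

lemma integral_path_law_0:
  fixes f :: "state \<Rightarrow> real"
  assumes [measurable]: "f \<in> borel_measurable (state_space M)"
  shows "(\<integral>\<omega>. f (state_at 0 \<omega>) \<partial>path_law M \<pi> x0) = f x0"
proof -
  have "(\<integral>\<omega>. f (state_at 0 \<omega>) \<partial>path_law M \<pi> x0) =
      (\<integral>y. f (snd y) \<partial>distr (path_law M \<pi> x0) (step_space M) (\<lambda>\<omega>. \<omega> 0))"
    by (subst integral_distr) (simp_all add: state_at_def)
  also have "\<dots> = f x0"
    unfolding distr_path_law_0 using initial_state by (subst integral_return) simp_all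
  finally show ?thesis .
qed

lemma integral_path_law_Suc:
  fixes f :: "real \<times> state \<Rightarrow> real"
  assumes [measurable]: "f \<in> borel_measurable (step_space M)"
    and bounded: "\<And>y. y \<in> space (step_space M) \<Longrightarrow> \<bar>f y\<bar> \<le> B"
  shows "(\<integral>\<omega>. f (\<omega> (Suc n)) \<partial>path_law M \<pi> x0) =
      (\<integral>\<omega>. (\<integral>y. f y \<partial>transition M (state_at n \<omega>) (\<pi> (state_at n \<omega>))) \<partial>path_law M \<pi> x0)"
proof -
  have "(\<integral>\<omega>. f (\<omega> (Suc n)) \<partial>path_law M \<pi> x0) =
      (\<integral>y. f y \<partial>distr (path_law M \<pi> x0) (step_space M) (\<lambda>\<omega>. \<omega> (Suc n)))"
    by (subst integral_distr) simp_all
  also have "\<dots> = (\<integral>\<omega>. (\<integral>y. f y \<partial>transition M (state_at n \<omega>) (\<pi> (state_at n \<omega>))) \<partial>path_law M \<pi> x0)"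
    unfolding distr_path_law_Suc
    using prob_space.emeasure_space_1[OF prob_space_transition[OF state_at_states]]
    by (intro integral_bind[where K="step_space M" and B=B and B'=1] transition_kernel bounded
         path.finite_measure_axioms AE_I2) simp_all
  finally show ?thesis .
qed

lemma AE_path_law_Suc:
  "AE \<omega> in path_law M \<pi> x0. 0 < fst (\<omega> (Suc n)) \<and> fst (\<omega> (Suc n)) \<le> period M"
proof -
  have "AE y in distr (path_law M \<pi> x0) (step_space M) (\<lambda>\<omega>. \<omega> (Suc n)). 0 < fst y \<and> fst y \<le> period M"
  proof -
    have "AE \<omega> in path_law M \<pi> x0. AE y in transition M (state_at n \<omega>) (\<pi> (state_at n \<omega>)).
        0 < fst y \<and> fst y \<le> period M"
      by (rule AE_I2, rule AE_transition, rule state_at_states)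
    then show ?thesis
      unfolding distr_path_law_Suc by (subst AE_bind[OF transition_kernel]) simp_all
  qed
  then show ?thesis
    by (subst (asm) AE_distr_iff) (simp_all del: space_step_space)
qed

end

section \<open>Long-run ratios along sample paths\<close>

context pm_system begin

text \<open>The mean of an exponential time of rate \<open>sojourn_rate M k\<close> cut off at \<open>r\<close>.\<close>

definition mean_sojourn_from :: "cond \<Rightarrow> real \<Rightarrow> real" where
  "mean_sojourn_from k r = (1 - exp (- sojourn_rate M k * r)) / sojourn_rate M k"

text \<open>Sojourn times lie in \<open>{0<..period M}\<close> only almost surely. Cutting the time coordinate off at these bounds
gives a bounded function on the whole space with the same integral, to which the formulas for bounded
integrands apply.\<close>

lemma mean_sojourn_eq_clipped:
  assumes x: "x \<in> states M"
  shows "mean_sojourn M x a = (\<integral>y. max 0 (min (period M) (fst y)) \<partial>transition M x a)"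
proof -
  have "mean_sojourn M x a = (\<integral>y. fst y \<partial>transition M x a)"
    unfolding mean_sojourn_def by (rule Bochner_Integration.integral_cong) auto
  also have "\<dots> = (\<integral>y. max 0 (min (period M) (fst y)) \<partial>transition M x a)"
  proof (rule integral_cong_AE)
    show "AE y in transition M x a. fst y = max 0 (min (period M) (fst y))"
      using AE_transition[OF x, of a] by eventually_elim simp
  qed (simp_all add: measurable_cong_sets[OF sets_transition refl])
  finally show ?thesis .
qed

lemma integral_sojourn_law_clipped:
  assumes r: "admissible_horizon r"
  shows "(\<integral>y. max 0 (min (period M) (fst y)) \<partial>sojourn_law M k r) = mean_sojourn_from k r"
proof -
  let ?a = "sojourn_rate M k"
  have r': "0 < r" "r \<le> period M" using r by (simp_all add: admissible_horizon_def)
  have a: "0 < ?a" by (rule sojourn_rate_pos)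
  let ?I = "- (r + 1 / ?a) * exp (- ?a * r) - (- (0 + 1 / ?a) * exp (- ?a * 0))"
  have "((\<lambda>s. ?a * s * exp (- ?a * s)) has_integral ?I) {0..r}"
    using r' a
    by (intro fundamental_theorem_of_calculus)
       (auto intro!: derivative_eq_intros simp: field_simps simp flip: has_real_derivative_iff_has_vector_derivative)
  then have "((\<lambda>s. ?a * s * exp (- ?a * s)) has_integral ?I) {0<..<r}"
    by (simp add: has_integral_Icc_iff_Ioo)
  then have "((\<lambda>s. exp (- ?a * s) * (rate M k * max 0 (min (period M) (fst (s, k, SC, r - s)))
      + uso_rate M * max 0 (min (period M) (fst (s, k, USO, r - s))))) has_integral ?I) {0<..<r}"
    by (rule has_integral_eq[rotated]) (use r' in \<open>auto simp: sojourn_rate_def algebra_simps\<close>)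
  from has_bochner_integral_sojourn_law[OF r _ _ this, of "period M"]
  have "(\<integral>y. max 0 (min (period M) (fst y)) \<partial>sojourn_law M k r)
      = ?I + exp (- ?a * r) * max 0 (min (period M) r)"
    using period_pos by (simp add: has_bochner_integral_iff)
  then show ?thesis
    using r' a by (simp add: mean_sojourn_from_def field_simps)
qed

lemma mean_sojourn_eq:
  assumes x: "x \<in> states M"
  shows "mean_sojourn M x a = (\<integral>k. mean_sojourn_from k (time_to_SO M x) \<partial>post_cond M x a)"
  unfolding mean_sojourn_eq_clipped[OF x]
  using period_pos
  by (subst integral_transition[OF x, where B="period M"])
     (simp_all add: integral_sojourn_law_clipped[OF time_to_SO_horizon[OF x]])

lemma abs_mean_sojourn_le:
  assumes x: "x \<in> states M"
  shows "\<bar>mean_sojourn M x a\<bar> \<le> period M"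
  unfolding mean_sojourn_eq_clipped[OF x]
  using period_pos by (intro abs_integral_transition_le[OF x]) simp_all

lemma measurable_integral_transition:
  fixes f :: "real \<times> state \<Rightarrow> real"
  assumes "\<pi> \<in> state_space M \<rightarrow>\<^sub>M count_space UNIV" "f \<in> borel_measurable (step_space M)"
  shows "(\<lambda>x. \<integral>y. f y \<partial>transition M x (\<pi> x)) \<in> borel_measurable (state_space M)"
  by (rule measurable_compose[OF measurable_transition[OF assms(1)] integral_measurable_subprob_algebra[OF assms(2)]])

lemma measurable_mean_sojourn:
  assumes "\<pi> \<in> state_space M \<rightarrow>\<^sub>M count_space UNIV"
  shows "(\<lambda>x. mean_sojourn M x (\<pi> x)) \<in> borel_measurable (state_space M)"
  unfolding mean_sojourn_def case_prod_beta
  by (rule measurable_integral_transition[OF assms]) simp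

lemma measurable_integral_next_state_law:
  fixes V :: "state \<Rightarrow> real"
  assumes "\<pi> \<in> state_space M \<rightarrow>\<^sub>M count_space UNIV" and [measurable]: "V \<in> borel_measurable (state_space M)"
  shows "(\<lambda>x. \<integral>y. V y \<partial>next_state_law M x (\<pi> x)) \<in> borel_measurable (state_space M)"
  unfolding integral_next_state_law[OF assms(2)]
  by (rule measurable_integral_transition[OF assms(1)]) simp

lemma abs_integral_next_state_law_le:
  fixes V :: "state \<Rightarrow> real"
  assumes x: "x \<in> states M" and V [measurable]: "V \<in> borel_measurable (state_space M)"
    and B: "\<And>x. x \<in> states M \<Longrightarrow> \<bar>V x\<bar> \<le> B"
  shows "\<bar>\<integral>y. V y \<partial>next_state_law M x a\<bar> \<le> B"
  unfolding integral_next_state_law[OF V]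
  using B[OF x] by (intro abs_integral_transition_le[OF x] AE_I2)
     (auto simp: space_transition intro!: B)

lemma cost_depends_on_type: "cost M (i, j, t) a = cost M (i, j, 0) a"
  by (cases a) simp_all

lemma measurable_cost:
  assumes \<pi>: "\<pi> \<in> state_space M \<rightarrow>\<^sub>M count_space UNIV"
  shows "(\<lambda>x. cost M x (\<pi> x)) \<in> borel_measurable (state_space M)"
proof -
  have "cost M x (\<pi> x) = cost M (fst x, fst (snd x), 0) (\<pi> x)" for x
    by (metis cost_depends_on_type prod.collapse)
  with measurable_of_type_and_action[OF \<pi>, of "\<lambda>i j a. cost M (i, j, 0) a"] show ?thesis
    by simp
qed

lemma abs_cost_le: "\<bar>cost M x a\<bar> \<le> \<bar>cost_cm M\<bar> + \<bar>cost_pm_so M\<bar> + \<bar>cost_pm_uso M\<bar>"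
  by (cases x; cases a) simp_all

lemma measurable_optimality_rhs:
  assumes "\<pi> \<in> state_space M \<rightarrow>\<^sub>M count_space UNIV" "V \<in> borel_measurable (state_space M)"
  shows "(\<lambda>x. optimality_rhs M V g x (\<pi> x)) \<in> borel_measurable (state_space M)"
  unfolding optimality_rhs_def
  using measurable_cost[OF assms(1)] measurable_integral_next_state_law[OF assms]
    measurable_mean_sojourn[OF assms(1)]
  by measurable

text \<open>Half of the least mean sojourn time that follows a scheduled opportunity. One half of that time is set
aside as a reserve for the sojourn just before the opportunity, the other half remains.\<close>

definition renewal_reserve :: real where
  "renewal_reserve = min (mean_sojourn_from Satisfactory (period M)) (mean_sojourn_from Perfect (period M)) / 2"

lemma renewal_reserve_pos: "0 < renewal_reserve"
proof -
  have "0 < mean_sojourn_from k (period M)" for k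
    using sojourn_rate_pos[of k] period_pos by (simp add: mean_sojourn_from_def)
  then show ?thesis by (simp add: renewal_reserve_def)
qed

lemma renewal_reserve_le: "2 * renewal_reserve \<le> mean_sojourn_from k (period M)"
  by (cases k) (simp_all add: renewal_reserve_def)

definition so_reserve :: "state \<Rightarrow> real" where
  "so_reserve x = (if fst (snd x) = SO then renewal_reserve else 0)"

lemma measurable_so_reserve [measurable]: "so_reserve \<in> borel_measurable (state_space M)"
  unfolding so_reserve_def by measurable

lemma so_reserve_bounds: "0 \<le> so_reserve x" "so_reserve x \<le> renewal_reserve"
  using renewal_reserve_pos by (simp_all add: so_reserve_def)

text \<open>Write \<open>A\<close> for \<open>renewal_reserve\<close>, \<open>\<alpha>\<close> for the sojourn rate and \<open>y = exp (- \<alpha> r)\<close> for the probability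
that the next epoch is a scheduled opportunity. Away from such an opportunity the mean sojourn time
and the expected reserve add up to \<open>(1 - y) / \<alpha> + y A\<close>, a convex combination of \<open>1 / \<alpha>\<close> and \<open>A\<close>, so
they are at least \<open>A\<close>, however small \<open>r\<close> is. At a scheduled opportunity the mean sojourn time is at
least \<open>2 A\<close>, of which \<open>A\<close> pays for the reserve that is used up.\<close>

lemma so_reserve_drift:
  assumes x: "x \<in> states M"
  shows "so_reserve x + renewal_reserve \<le> mean_sojourn M x a + (\<integral>y. so_reserve y \<partial>next_state_law M x a)"
proof -
  note r = time_to_SO_horizon[OF x]
  let ?r = "time_to_SO M x" and ?A = renewal_reserve
  have "(\<integral>y. so_reserve (snd y) \<partial>sojourn_law M k ?r) = exp (- sojourn_rate M k * ?r) * ?A" for k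
  proof -
    have "((\<lambda>s. exp (- sojourn_rate M k * s) * (rate M k * so_reserve (snd (s, k, SC, ?r - s))
       + uso_rate M * so_reserve (snd (s, k, USO, ?r - s)))) has_integral 0) {0<..<?r}"
      by (simp add: so_reserve_def)
    from has_bochner_integral_sojourn_law[OF r _ _ this, of ?A] so_reserve_bounds show ?thesis
      by (simp add: has_bochner_integral_iff) (simp add: so_reserve_def)
  qed
  then have "mean_sojourn M x a + (\<integral>y. so_reserve y \<partial>next_state_law M x a) =
     (\<integral>k. mean_sojourn_from k ?r \<partial>post_cond M x a) + (\<integral>k. exp (- sojourn_rate M k * ?r) * ?A \<partial>post_cond M x a)"
    unfolding mean_sojourn_eq[OF x] integral_next_state_law[OF measurable_so_reserve]
    using so_reserve_bounds by (subst integral_transition[OF x, where B="?A"]) simp_all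
  also have "\<dots> = (\<integral>k. mean_sojourn_from k ?r + exp (- sojourn_rate M k * ?r) * ?A \<partial>post_cond M x a)"
    by (rule Bochner_Integration.integral_add[symmetric]) (simp_all add: integrable_measure_pmf_finite)
  also have "so_reserve x + ?A \<le> \<dots>"
  proof (rule measure_pmf.integral_ge_const)
    have "so_reserve x + ?A \<le> mean_sojourn_from k ?r + exp (- sojourn_rate M k * ?r) * ?A" for k
    proof (cases "fst (snd x) = SO")
      case True
      then have "?r = period M" by (cases x) simp
      moreover have "0 \<le> exp (- sojourn_rate M k * ?r) * ?A"
        using renewal_reserve_pos by simp
      ultimately show ?thesis
        using renewal_reserve_le[of k] True by (simp add: so_reserve_def)
    next
      case False
      let ?y = "exp (- sojourn_rate M k * ?r)"
      have "?A \<le> 2 * ?A" using renewal_reserve_pos by simp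
      also have "\<dots> \<le> mean_sojourn_from k (period M)" by (rule renewal_reserve_le)
      also have "\<dots> \<le> 1 / sojourn_rate M k"
        using sojourn_rate_pos[of k] by (simp add: mean_sojourn_from_def divide_right_mono)
      finally have "0 \<le> (1 - ?y) * (1 / sojourn_rate M k - ?A)"
        using sojourn_rate_pos[of k] r by (intro mult_nonneg_nonneg) (simp_all add: admissible_horizon_def)
      also have "\<dots> = mean_sojourn_from k ?r + ?y * ?A - ?A"
        by (simp add: mean_sojourn_from_def algebra_simps diff_divide_distrib)
      finally show ?thesis using False by (simp add: so_reserve_def)
    qed
    then show "AE k in post_cond M x a. so_reserve x + ?A \<le> mean_sojourn_from k ?r + exp (- sojourn_rate M k * ?r) * ?A"
      by simp
  qed (simp add: integrable_measure_pmf_finite)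
  finally show ?thesis .
qed

end

context pm_system_policy begin

lemma integrable_state_at:
  fixes f :: "state \<Rightarrow> real"
  assumes [measurable]: "f \<in> borel_measurable (state_space M)"
    and B: "\<And>x. x \<in> states M \<Longrightarrow> \<bar>f x\<bar> \<le> B"
  shows "integrable (path_law M \<pi> x0) (\<lambda>\<omega>. f (state_at n \<omega>))"
  by (rule path.integrable_const_bound[where B=B])
     (auto intro!: AE_I2 B state_at_states simp del: space_path_law)

text \<open>Dynkin's formula: by the Markov property each summand is an increment of the expectation of \<open>V\<close>
along the path, and the increments telescope.\<close>

lemma dynkin_formula:
  fixes V :: "state \<Rightarrow> real"
  assumes V [measurable]: "V \<in> borel_measurable (state_space M)"
    and B: "\<And>x. x \<in> states M \<Longrightarrow> \<bar>V x\<bar> \<le> B"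
  shows "(\<Sum>k<n. (\<integral>\<omega>. (\<integral>y. V y \<partial>next_state_law M (state_at k \<omega>) (\<pi> (state_at k \<omega>))) \<partial>path_law M \<pi> x0)
      - (\<integral>\<omega>. V (state_at k \<omega>) \<partial>path_law M \<pi> x0)) = (\<integral>\<omega>. V (state_at n \<omega>) \<partial>path_law M \<pi> x0) - V x0"
proof -
  have "(\<integral>\<omega>. V (state_at (Suc k) \<omega>) \<partial>path_law M \<pi> x0) =
     (\<integral>\<omega>. (\<integral>y. V y \<partial>next_state_law M (state_at k \<omega>) (\<pi> (state_at k \<omega>))) \<partial>path_law M \<pi> x0)" for k
    unfolding integral_next_state_law[OF V]
    using integral_path_law_Suc[of "\<lambda>y. V (snd y)" B k] B by (force simp: state_at_def)
  then show ?thesis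
    using sum_lessThan_telescope[of "\<lambda>k. \<integral>\<omega>. V (state_at k \<omega>) \<partial>path_law M \<pi> x0" n]
    by (simp add: integral_path_law_0)
qed

lemma expected_cost_eq_sum:
  "expected_cost M \<pi> x0 n = (\<Sum>k<n. \<integral>\<omega>. cost M (state_at k \<omega>) (\<pi> (state_at k \<omega>)) \<partial>path_law M \<pi> x0)"
  unfolding expected_cost_def
  by (rule Bochner_Integration.integral_sum integrable_state_at measurable_cost policy_measurable abs_cost_le)+

lemma expected_mean_sojourns_eq_sum:
  "expected_mean_sojourns M \<pi> x0 n =
     (\<Sum>k<n. \<integral>\<omega>. mean_sojourn M (state_at k \<omega>) (\<pi> (state_at k \<omega>)) \<partial>path_law M \<pi> x0)"
  unfolding expected_mean_sojourns_def
  by (rule Bochner_Integration.integral_sum integrable_state_at measurable_mean_sojourn policy_measurable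
      abs_mean_sojourn_le | assumption)+

lemma expected_time_eq: "expected_time M \<pi> x0 n = expected_mean_sojourns M \<pi> x0 n"
proof -
  let ?clip = "\<lambda>y :: real \<times> state. max 0 (min (period M) (fst y))"
  have clip: "AE \<omega> in path_law M \<pi> x0. ?clip (\<omega> (Suc k)) = fst (\<omega> (Suc k))" for k
    using AE_path_law_Suc[of k] by eventually_elim simp
  have int_clip: "integrable (path_law M \<pi> x0) (\<lambda>\<omega>. ?clip (\<omega> (Suc k)))" for k
    using period_pos by (intro path.integrable_const_bound[where B="period M"]) simp_all
  have "integrable (path_law M \<pi> x0) (\<lambda>\<omega>. fst (\<omega> (Suc k)))" for k
    by (rule integrable_cong_AE_imp[OF int_clip _ clip]) simp
  moreover have "(\<integral>\<omega>. fst (\<omega> (Suc k)) \<partial>path_law M \<pi> x0) =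
      (\<integral>\<omega>. mean_sojourn M (state_at k \<omega>) (\<pi> (state_at k \<omega>)) \<partial>path_law M \<pi> x0)" for k
  proof -
    have "(\<integral>\<omega>. fst (\<omega> (Suc k)) \<partial>path_law M \<pi> x0) = (\<integral>\<omega>. ?clip (\<omega> (Suc k)) \<partial>path_law M \<pi> x0)"
      using clip by (intro integral_cong_AE[symmetric]) simp_all
    also have "\<dots> = (\<integral>\<omega>. (\<integral>y. ?clip y \<partial>transition M (state_at k \<omega>) (\<pi> (state_at k \<omega>))) \<partial>path_law M \<pi> x0)"
      using period_pos by (intro integral_path_law_Suc[where B="period M"]) simp_all
    also have "\<dots> = (\<integral>\<omega>. mean_sojourn M (state_at k \<omega>) (\<pi> (state_at k \<omega>)) \<partial>path_law M \<pi> x0)"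
      by (intro Bochner_Integration.integral_cong refl mean_sojourn_eq_clipped[symmetric] state_at_states)
    finally show ?thesis .
  qed
  ultimately show ?thesis
    unfolding expected_time_def transition_time_def expected_mean_sojourns_eq_sum
    by (simp add: sum.atLeast1_atMost_eq)
qed

text \<open>Summing the drift inequality along the path, where the reserve itself contributes only a
bounded telescoping term.\<close>

lemma expected_mean_sojourns_linear_growth:
  "real n * renewal_reserve - renewal_reserve \<le> expected_mean_sojourns M \<pi> x0 n"
proof -
  let ?E = "\<lambda>f. \<integral>\<omega>. f \<omega> \<partial>path_law M \<pi> x0"
  let ?U = "\<lambda>k. ?E (\<lambda>\<omega>. so_reserve (state_at k \<omega>))"
  let ?PU = "\<lambda>k. ?E (\<lambda>\<omega>. \<integral>y. so_reserve y \<partial>next_state_law M (state_at k \<omega>) (\<pi> (state_at k \<omega>)))"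
  let ?\<tau> = "\<lambda>k. ?E (\<lambda>\<omega>. mean_sojourn M (state_at k \<omega>) (\<pi> (state_at k \<omega>)))"
  have abs_U: "\<bar>so_reserve x\<bar> \<le> renewal_reserve" for x
    using so_reserve_bounds by simp
  have i1: "integrable (path_law M \<pi> x0) (\<lambda>\<omega>. so_reserve (state_at k \<omega>))" for k
    by (rule integrable_state_at[OF measurable_so_reserve abs_U])
  have i2: "integrable (path_law M \<pi> x0) (\<lambda>\<omega>. \<integral>y. so_reserve y \<partial>next_state_law M (state_at k \<omega>) (\<pi> (state_at k \<omega>)))" for k
    by (rule integrable_state_at[OF measurable_integral_next_state_law[OF policy_measurable measurable_so_reserve]
         abs_integral_next_state_law_le[OF _ measurable_so_reserve abs_U]])
  have i3: "integrable (path_law M \<pi> x0) (\<lambda>\<omega>. mean_sojourn M (state_at k \<omega>) (\<pi> (state_at k \<omega>)))" for k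
    by (rule integrable_state_at[OF measurable_mean_sojourn[OF policy_measurable] abs_mean_sojourn_le])
  have "?U k + renewal_reserve \<le> ?\<tau> k + ?PU k" for k
  proof -
    have "?U k + renewal_reserve = ?E (\<lambda>\<omega>. so_reserve (state_at k \<omega>) + renewal_reserve)"
      using path.prob_space i1 by simp
    also have "\<dots> \<le> ?E (\<lambda>\<omega>. mean_sojourn M (state_at k \<omega>) (\<pi> (state_at k \<omega>)) +
        (\<integral>y. so_reserve y \<partial>next_state_law M (state_at k \<omega>) (\<pi> (state_at k \<omega>))))"
      using i1 i2 i3 by (intro integral_mono so_reserve_drift state_at_states) simp_all
    also have "\<dots> = ?\<tau> k + ?PU k"
      by (rule Bochner_Integration.integral_add[OF i3 i2])
    finally show ?thesis .
  qed
  then have "(\<Sum>k<n. renewal_reserve) \<le> (\<Sum>k<n. ?\<tau> k + (?PU k - ?U k))"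
    by (intro sum_mono) (simp add: algebra_simps)
  also have "\<dots> = expected_mean_sojourns M \<pi> x0 n + (?U n - so_reserve x0)"
    unfolding sum.distrib dynkin_formula[OF measurable_so_reserve abs_U] expected_mean_sojourns_eq_sum ..
  also have "?U n \<le> renewal_reserve"
    using so_reserve_bounds i1 by (intro path.integral_le_const AE_I2) simp_all
  finally show ?thesis
    using so_reserve_bounds(1)[of x0] by simp
qed

lemma expected_mean_sojourns_at_top:
  "filterlim (expected_mean_sojourns M \<pi> x0) at_top sequentially"
proof (rule filterlim_at_top_mono)
  show "filterlim (\<lambda>n. real n * renewal_reserve - renewal_reserve) at_top sequentially"
    using renewal_reserve_pos by real_asymp
qed (use expected_mean_sojourns_linear_growth in simp)

text \<open>The last sum collects the losses of the policy in the optimality equation: its terms are nonnegative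
for every policy and zero for a minimising one, when \<open>V\<close> and \<open>g\<close> solve that equation.\<close>

lemma expected_cost_eq:
  assumes V [measurable]: "V \<in> borel_measurable (state_space M)"
    and B: "\<And>x. x \<in> states M \<Longrightarrow> \<bar>V x\<bar> \<le> B"
  shows "expected_cost M \<pi> x0 n - g * expected_mean_sojourns M \<pi> x0 n =
    V x0 - (\<integral>\<omega>. V (state_at n \<omega>) \<partial>path_law M \<pi> x0) +
    (\<Sum>k<n. \<integral>\<omega>. optimality_rhs M V g (state_at k \<omega>) (\<pi> (state_at k \<omega>)) - V (state_at k \<omega>) \<partial>path_law M \<pi> x0)"
proof -
  have "(\<integral>\<omega>. optimality_rhs M V g (state_at k \<omega>) (\<pi> (state_at k \<omega>)) - V (state_at k \<omega>) \<partial>path_law M \<pi> x0)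
    = (\<integral>\<omega>. cost M (state_at k \<omega>) (\<pi> (state_at k \<omega>)) \<partial>path_law M \<pi> x0)
     - g * (\<integral>\<omega>. mean_sojourn M (state_at k \<omega>) (\<pi> (state_at k \<omega>)) \<partial>path_law M \<pi> x0)
     + ((\<integral>\<omega>. (\<integral>y. V y \<partial>next_state_law M (state_at k \<omega>) (\<pi> (state_at k \<omega>))) \<partial>path_law M \<pi> x0)
      - (\<integral>\<omega>. V (state_at k \<omega>) \<partial>path_law M \<pi> x0))" for k
    using integrable_state_at[OF measurable_cost[OF policy_measurable] abs_cost_le, of k]
      integrable_state_at[OF measurable_mean_sojourn[OF policy_measurable] abs_mean_sojourn_le, of k]
      integrable_state_at[OF measurable_integral_next_state_law[OF policy_measurable V]
         abs_integral_next_state_law_le[OF _ V B], of k]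
      integrable_state_at[OF V B, of k]
    by (simp add: optimality_rhs_def)
  then show ?thesis
    using dynkin_formula[OF V B, of n]
    by (simp add: expected_cost_eq_sum expected_mean_sojourns_eq_sum sum.distrib sum_subtractf sum_distrib_left)
qed

lemma abs_integral_state_at_le:
  fixes V :: "state \<Rightarrow> real"
  assumes V [measurable]: "V \<in> borel_measurable (state_space M)"
    and B: "\<And>x. x \<in> states M \<Longrightarrow> \<bar>V x\<bar> \<le> B"
  shows "\<bar>V x0 - (\<integral>\<omega>. V (state_at n \<omega>) \<partial>path_law M \<pi> x0)\<bar> \<le> 2 * B"
proof -
  have "-B \<le> (\<integral>\<omega>. V (state_at n \<omega>) \<partial>path_law M \<pi> x0)" "(\<integral>\<omega>. V (state_at n \<omega>) \<partial>path_law M \<pi> x0) \<le> B"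
    using B[OF state_at_states, of _ n]
    by (intro path.integral_le_const path.integral_ge_const AE_I2 integrable_state_at[OF V B]; force)+
  then show ?thesis using B[OF initial_state] by linarith
qed

text \<open>The expected cost exceeds \<open>g\<close> times the expected duration minus a constant, and the duration tends
to infinity.\<close>

lemma ratio_average_cost_ge:
  assumes V: "V \<in> borel_measurable (state_space M)" "\<And>x. x \<in> states M \<Longrightarrow> \<bar>V x\<bar> \<le> B"
    and opt: "\<And>x. x \<in> states M \<Longrightarrow> V x \<le> optimality_rhs M V g x (\<pi> x)"
  shows "ereal g \<le> ratio_average_cost M x0 \<pi>"
proof -
  let ?T = "expected_mean_sojourns M \<pi> x0"
  have lim: "(\<lambda>n. g - 2 * B / ?T n) \<longlonglongrightarrow> g"
    using tendsto_diff[OF tendsto_const[of g] tendsto_divide_0[OF tendsto_const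
       filterlim_at_top_imp_at_infinity[OF expected_mean_sojourns_at_top], of "2 * B"]] by simp
  have "ereal g = limsup (\<lambda>n. ereal (g - 2 * B / ?T n))"
    using lim by (intro lim_imp_Limsup[symmetric]) simp_all
  also have "\<dots> \<le> ratio_average_cost M x0 \<pi>"
    unfolding ratio_average_cost_def expected_time_eq
  proof (rule Limsup_mono)
    have "eventually (\<lambda>n. 0 < ?T n) sequentially"
      using expected_mean_sojourns_at_top by (simp add: filterlim_at_top_dense)
    then show "eventually (\<lambda>n. ereal (g - 2 * B / ?T n) \<le> ereal (expected_cost M \<pi> x0 n / ?T n)) sequentially"
    proof eventually_elim
      fix n assume "0 < ?T n"
      have "0 \<le> (\<Sum>k<n. \<integral>\<omega>. optimality_rhs M V g (state_at k \<omega>) (\<pi> (state_at k \<omega>)) - V (state_at k \<omega>) \<partial>path_law M \<pi> x0)"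
        using opt by (intro sum_nonneg integral_nonneg_AE AE_I2) (simp add: state_at_states del: space_path_law)
      then have "g * ?T n - 2 * B \<le> expected_cost M \<pi> x0 n"
        using expected_cost_eq[OF V, where g=g and n=n] abs_integral_state_at_le[OF V, where n=n] by linarith
      then have "(g * ?T n - 2 * B) / ?T n \<le> expected_cost M \<pi> x0 n / ?T n"
        using \<open>0 < ?T n\<close> by (intro divide_right_mono) simp_all
      then show "ereal (g - 2 * B / ?T n) \<le> ereal (expected_cost M \<pi> x0 n / ?T n)"
        using \<open>0 < ?T n\<close> by (simp add: diff_divide_distrib)
    qed
  qed
  finally show ?thesis .
qed

lemma ratio_average_cost_eq:
  assumes V: "V \<in> borel_measurable (state_space M)" "\<And>x. x \<in> states M \<Longrightarrow> \<bar>V x\<bar> \<le> B"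
    and opt: "\<And>x. x \<in> states M \<Longrightarrow> V x = optimality_rhs M V g x (\<pi> x)"
  shows "ratio_average_cost M x0 \<pi> = ereal g"
proof (rule antisym)
  let ?T = "expected_mean_sojourns M \<pi> x0"
  have lim: "(\<lambda>n. g + 2 * B / ?T n) \<longlonglongrightarrow> g"
    using tendsto_add[OF tendsto_const[of g] tendsto_divide_0[OF tendsto_const
       filterlim_at_top_imp_at_infinity[OF expected_mean_sojourns_at_top], of "2 * B"]] by simp
  have "ratio_average_cost M x0 \<pi> \<le> limsup (\<lambda>n. ereal (g + 2 * B / ?T n))"
    unfolding ratio_average_cost_def expected_time_eq
  proof (rule Limsup_mono)
    have "eventually (\<lambda>n. 0 < ?T n) sequentially"
      using expected_mean_sojourns_at_top by (simp add: filterlim_at_top_dense)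
    then show "eventually (\<lambda>n. ereal (expected_cost M \<pi> x0 n / ?T n) \<le> ereal (g + 2 * B / ?T n)) sequentially"
    proof eventually_elim
      fix n assume "0 < ?T n"
      have "(\<integral>\<omega>. optimality_rhs M V g (state_at k \<omega>) (\<pi> (state_at k \<omega>)) - V (state_at k \<omega>) \<partial>path_law M \<pi> x0)
          = (\<integral>\<omega>. 0 \<partial>path_law M \<pi> x0)" for k
        using opt[OF state_at_states] by (intro Bochner_Integration.integral_cong refl) simp
      then have "expected_cost M \<pi> x0 n \<le> g * ?T n + 2 * B"
        using expected_cost_eq[OF V, where g=g and n=n] abs_integral_state_at_le[OF V, where n=n] by simp
      then have "expected_cost M \<pi> x0 n / ?T n \<le> (g * ?T n + 2 * B) / ?T n"
        using \<open>0 < ?T n\<close> by (intro divide_right_mono) simp_all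
      then show "ereal (expected_cost M \<pi> x0 n / ?T n) \<le> ereal (g + 2 * B / ?T n)"
        using \<open>0 < ?T n\<close> by (simp add: add_divide_distrib)
    qed
  qed
  also have "\<dots> = ereal g"
    using lim by (intro lim_imp_Limsup) simp_all
  finally show "ratio_average_cost M x0 \<pi> \<le> ereal g" .
  show "ereal g \<le> ratio_average_cost M x0 \<pi>"
    using opt by (intro ratio_average_cost_ge[OF V]) simp_all
qed

end

section \<open>The relative value function\<close>

text \<open>One step of the optimality equation: the value of a state when \<open>w k r\<close> is the value of continuing in
condition \<open>k\<close> with the next scheduled opportunity \<open>r\<close> time units away.\<close>

fun state_value :: "pm_model \<Rightarrow> (cond \<Rightarrow> real \<Rightarrow> real) \<Rightarrow> state \<Rightarrow> real" where
  "state_value M w (Perfect, SC, t) = w Satisfactory t"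
| "state_value M w (Satisfactory, SC, t) = cost_cm M + w Perfect t"
| "state_value M w (i, USO, t) =
     min (cost_pm_uso M + (pm_success M * w Perfect t + (1 - pm_success M) * w i t)) (w i t)"
| "state_value M w (i, SO, t) =
     min (cost_pm_so M + (pm_success M * w Perfect (period M) + (1 - pm_success M) * w i (period M))) (w i (period M))"

text \<open>The differential form of conditioning on the next epoch: the condition changes at rate \<open>rate M k\<close>,
unscheduled opportunities occur at rate \<open>uso_rate M\<close>, and time costs \<open>g\<close> per unit. The derivative
is taken with respect to the remaining time; at remaining time \<open>0\<close> a scheduled opportunity has
arrived. Continuity on the whole line makes the state value measurable in the time component.\<close>

definition solves_value_ode :: "pm_model \<Rightarrow> (cond \<Rightarrow> real \<Rightarrow> real) \<Rightarrow> real \<Rightarrow> bool" where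
  "solves_value_ode M w g \<longleftrightarrow> (\<forall>k. continuous_on UNIV (w k) \<and> w k 0 = state_value M w (k, SO, 0) \<and>
     (\<forall>t\<in>{0..period M}. (w k has_real_derivative
        (rate M k * state_value M w (k, SC, t) + uso_rate M * state_value M w (k, USO, t)
          - sojourn_rate M k * w k t - g)) (at t within {0..period M})))"

context pm_system begin

text \<open>With \<open>h = w Satisfactory - w Perfect\<close>, maintenance at an unscheduled opportunity changes the value
in condition \<open>Satisfactory\<close> by \<open>min (cost_pm_uso M - p h) 0 = min (p h) (cost_pm_uso M) - p h\<close>, and in
condition \<open>Perfect\<close> it is never worth its positive cost. Hence \<open>h\<close> satisfies
\<open>h' = G h - (\<mu>\<^sub>1 + \<mu>\<^sub>2 + \<lambda> p) h\<close> with the \<open>G\<close> below, and likewise the decision at a scheduled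
opportunity becomes \<open>h 0 = H (h (period M))\<close>. The value in condition \<open>Perfect\<close> is then an integral.\<close>

lemma exists_value_ode_solution: "\<exists>w g. solves_value_ode M w g"
proof -
  let ?p = "pm_success M" and ?T = "period M" and ?l = "uso_rate M"
  let ?m1 = "rate M Satisfactory" and ?m2 = "rate M Perfect"
  let ?c1 = "cost_pm_so M" and ?c2 = "cost_pm_uso M" and ?c = "cost_cm M"
  define G where "G x = ?m1 * ?c + ?l * min (?p * x) ?c2" for x
  define H where "H x = min (?c1 + (1 - ?p) * x) x" for x
  have p: "0 < ?p" "?p \<le> 1" by (fact pm_success_pos pm_success_le_1)+
  have "\<exists>h. h 0 = H (h ?T) \<and> (\<forall>t\<in>{0..?T}. (h has_real_derivative
      (G (h t) - (?m1 + ?m2 + ?l * ?p) * h t)) (at t within {0..?T}))"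
  proof (rule dissipative_ode_boundary_value[where L="?l * ?p"])
    show "\<bar>G x - G y\<bar> \<le> ?l * ?p * \<bar>x - y\<bar>" for x y
    proof -
      have "\<bar>min (?p * x) ?c2 - min (?p * y) ?c2\<bar> \<le> \<bar>?p * x - ?p * y\<bar>" by linarith
      also have "\<dots> = ?p * \<bar>x - y\<bar>" using p by (simp add: abs_mult flip: right_diff_distrib)
      finally have "?l * \<bar>min (?p * x) ?c2 - min (?p * y) ?c2\<bar> \<le> ?l * (?p * \<bar>x - y\<bar>)"
        using uso_rate_pos by simp
      moreover have "\<bar>G x - G y\<bar> = ?l * \<bar>min (?p * x) ?c2 - min (?p * y) ?c2\<bar>"
        using uso_rate_pos by (simp add: G_def abs_mult flip: right_diff_distrib)
      ultimately show ?thesis by simp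
    qed
    show "\<bar>H x - H y\<bar> \<le> \<bar>x - y\<bar>" for x y
    proof -
      have "\<bar>(1 - ?p) * x - (1 - ?p) * y\<bar> = (1 - ?p) * \<bar>x - y\<bar>"
        using p by (simp add: abs_mult flip: right_diff_distrib)
      also have "\<dots> \<le> \<bar>x - y\<bar>" using p by (simp add: mult_left_le_one_le)
      finally show ?thesis unfolding H_def by linarith
    qed
  qed (use period_pos p uso_rate_pos rate_pos in \<open>simp_all add: add_pos_pos\<close>)
  then obtain h where h0: "h 0 = H (h ?T)"
    and h': "\<And>t. t \<in> {0..?T} \<Longrightarrow> (h has_real_derivative (G (h t) - (?m1 + ?m2 + ?l * ?p) * h t)) (at t within {0..?T})"
    by blast
  have cont_h: "continuous_on {0..?T} h"
    using h' by (intro DERIV_continuous_on)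
  \<comment> \<open>The only choice of \<open>g\<close> that gives \<open>v\<close> the same value at both ends of the period.\<close>
  define g where "g = ?m2 / ?T * integral {0..?T} h"
  define v where "v t = integral {0..t} (\<lambda>s. ?m2 * h s - g)" for t
  have v': "(v has_real_derivative (?m2 * h t - g)) (at t within {0..?T})" if "t \<in> {0..?T}" for t
    unfolding v_def by (intro integral_has_real_derivative continuous_intros cont_h that)
  have v0: "v 0 = 0" by (simp add: v_def)
  have vT: "v ?T = 0"
  proof -
    have "v ?T = ?m2 * integral {0..?T} h - ?T * g"
      unfolding v_def using period_pos
      by (subst integral_diff) (auto intro!: integrable_continuous_real continuous_intros cont_h)
    then show ?thesis using period_pos by (simp add: g_def)
  qed
  define clip where "clip t = max 0 (min ?T t)" for t
  have clip: "clip t \<in> {0..?T}" "t \<in> {0..?T} \<Longrightarrow> clip t = t" for t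
    using period_pos by (auto simp: clip_def)
  have cont_clip: "continuous_on UNIV clip"
    unfolding clip_def by (intro continuous_intros)
  define u where "u k t = (case k of Perfect \<Rightarrow> v t | Satisfactory \<Rightarrow> v t + h t)" for k t
  define w where "w k t = u k (clip t)" for k t
  have w_eq: "w k t = u k t" if "t \<in> {0..?T}" for k t
    using clip(2)[OF that] by (simp add: w_def)
  have T: "0 \<in> {0..?T}" "?T \<in> {0..?T}" using period_pos by simp_all
  have uso: "state_value M w (Perfect, USO, t) = v t"
    "state_value M w (Satisfactory, USO, t) = v t + h t - ?p * h t + min (?p * h t) ?c2"
    if "t \<in> {0..?T}" for t
    using cost_pm_uso_pos by (simp_all add: w_eq[OF that] u_def algebra_simps min_def)
  have "solves_value_ode M w g"
    unfolding solves_value_ode_def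
  proof (intro allI conjI ballI)
    fix k
    have u': "(u k has_real_derivative (rate M k * state_value M w (k, SC, t) + ?l * state_value M w (k, USO, t)
        - sojourn_rate M k * w k t - g)) (at t within {0..?T})" if t: "t \<in> {0..?T}" for t
    proof (cases k)
      case Perfect
      then have "u k = v" by (simp add: u_def fun_eq_iff)
      moreover have "rate M k * state_value M w (k, SC, t) + ?l * state_value M w (k, USO, t)
          - sojourn_rate M k * w k t - g = ?m2 * h t - g"
        using t by (simp add: Perfect uso w_eq u_def sojourn_rate_def algebra_simps del: state_value.simps(3))
      ultimately show ?thesis using v'[OF t] by (simp only:)
    next
      case Satisfactory
      then have "u k = (\<lambda>t. v t + h t)" by (simp add: u_def fun_eq_iff)
      moreover have "rate M k * state_value M w (k, SC, t) + ?l * state_value M w (k, USO, t)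
          - sojourn_rate M k * w k t - g =
          (?m2 * h t - g) + (G (h t) - (?m1 + ?m2 + ?l * ?p) * h t)"
        using t by (simp add: Satisfactory uso w_eq u_def sojourn_rate_def G_def algebra_simps del: state_value.simps(3))
      ultimately show ?thesis using DERIV_add[OF v'[OF t] h'[OF t]] by (simp only:)
    qed
    show "(w k has_real_derivative (rate M k * state_value M w (k, SC, t) + ?l * state_value M w (k, USO, t)
        - sojourn_rate M k * w k t - g)) (at t within {0..?T})" if t: "t \<in> {0..?T}" for t
      by (rule has_field_derivative_transform_within[OF u'[OF t] zero_less_one t]) (simp add: w_eq)
    have "continuous_on {0..?T} (u k)"
      using u' by (rule DERIV_continuous_on)
    then show "continuous_on UNIV (w k)"
      unfolding w_def by (rule continuous_on_compose2[OF _ cont_clip]) (use clip in auto)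
    show "w k 0 = state_value M w (k, SO, 0)"
    proof (cases k)
      case Perfect
      then show ?thesis
        using cost_pm_so_pos T by (simp add: w_eq u_def v0 vT)
    next
      case Satisfactory
      then show ?thesis
        using T h0 by (simp add: w_eq u_def v0 vT H_def)
    qed
  qed
  then show ?thesis by blast
qed

end

locale value_ode_solution = pm_system +
  fixes w :: "cond \<Rightarrow> real \<Rightarrow> real" and g :: real
  assumes value_ode: "solves_value_ode M w g"
begin

lemma continuous_w: "continuous_on A (w k)"
  using value_ode unfolding solves_value_ode_def by (blast intro: continuous_on_subset)

lemma measurable_w [measurable]: "w k \<in> borel_measurable borel"
  by (rule borel_measurable_continuous_onI[OF continuous_w])

lemma w_0: "w k 0 = state_value M w (k, SO, 0)"
  using value_ode by (auto simp: solves_value_ode_def)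

lemma w_deriv:
  "t \<in> {0..period M} \<Longrightarrow> (w k has_real_derivative
        (rate M k * state_value M w (k, SC, t) + uso_rate M * state_value M w (k, USO, t)
          - sojourn_rate M k * w k t - g)) (at t within {0..period M})"
  using value_ode by (auto simp: solves_value_ode_def)

lemma measurable_state_value [measurable]: "state_value M w \<in> borel_measurable (state_space M)"
proof -
  have "(\<lambda>x. state_value M w (i, j, snd (snd x))) \<in> borel_measurable (state_space M)" for i j
    by (cases i; cases j) simp_all
  then have "(\<lambda>x. state_value M w (i, fst (snd x), snd (snd x))) \<in> borel_measurable (state_space M)" for i
    by (intro measurable_compose_countable'[where f="\<lambda>j x. state_value M w (i, j, snd (snd x))"
          and g="\<lambda>x. fst (snd x)" and I=UNIV])
       (simp_all add: countable_finite finite_UNIV_epoch)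
  then have "(\<lambda>x. state_value M w (fst x, fst (snd x), snd (snd x))) \<in> borel_measurable (state_space M)"
    by (intro measurable_compose_countable'[where f="\<lambda>i x. state_value M w (i, fst (snd x), snd (snd x))"
          and g=fst and I=UNIV])
       (simp_all add: countable_finite)
  then show ?thesis by simp
qed

lemma bounded_state_value: "bounded (state_value M w ` states M)"
proof -
  let ?F = "\<lambda>(i, j). (\<lambda>t. state_value M w (i, j, t)) ` {0..period M}"
  have "continuous_on {0..period M} (\<lambda>t. state_value M w (i, j, t))" for i j
    by (cases i; cases j) (auto intro!: continuous_intros continuous_w)
  then have "bounded (?F ij)" for ij
    by (cases ij) (auto intro!: compact_imp_bounded compact_continuous_image)
  moreover have "finite (UNIV :: (cond \<times> epoch) set)"
    by (simp add: finite_prod finite_UNIV_epoch)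
  ultimately have "bounded (\<Union>ij. ?F ij)"
    by (intro bounded_UN) auto
  moreover have "state_value M w ` states M \<subseteq> (\<Union>ij. ?F ij)"
    using period_pos by (fastforce simp: states_def)
  ultimately show ?thesis by (rule bounded_subset)
qed

lemma abs_state_value_bound:
  obtains B where "\<And>x. x \<in> states M \<Longrightarrow> \<bar>state_value M w x\<bar> \<le> B"
  using bounded_state_value by (auto simp: bounded_iff)

text \<open>The integral form of the differential equation: \<open>s \<mapsto> - exp (- \<alpha> s) w k (r - s)\<close> is an antiderivative of the
discounted running value, and the boundary term at \<open>s = r\<close> is the value of the scheduled
opportunity weighted with the probability of reaching it.\<close>

lemma continuation_value:
  assumes r: "admissible_horizon r"
  shows "(\<integral>y. state_value M w (snd y) \<partial>sojourn_law M k r) = w k r + g * mean_sojourn_from k r"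
proof -
  obtain B where B: "\<And>x. x \<in> states M \<Longrightarrow> \<bar>state_value M w x\<bar> \<le> B"
    using abs_state_value_bound by blast
  let ?a = "sojourn_rate M k"
  have r': "0 < r" "r \<le> period M" using r by (simp_all add: admissible_horizon_def)
  have a: "0 < ?a" by (rule sojourn_rate_pos)
  let ?S = "\<lambda>t. rate M k * state_value M w (k, SC, t) + uso_rate M * state_value M w (k, USO, t)"
  have "((\<lambda>s. exp (- ?a * s) * (?S (r - s) - g)) has_integral
      (- exp (- ?a * r) * w k (r - r) - (- exp (- ?a * 0) * w k (r - 0)))) {0..r}"
  proof (rule fundamental_theorem_of_calculus)
    fix s assume s: "s \<in> {0..r}"
    have "(w k has_real_derivative (?S (r - s) - ?a * w k (r - s) - g)) (at (r - s) within {0..period M})"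
      using s r' by (intro w_deriv) auto
    then have "(w k has_real_derivative (?S (r - s) - ?a * w k (r - s) - g)) (at (r - s) within (\<lambda>s. r - s) ` {0..r})"
      by (rule DERIV_subset) (use r' in auto)
    then have "((\<lambda>s. w k (r - s)) has_real_derivative (?S (r - s) - ?a * w k (r - s) - g) * (-1)) (at s within {0..r})"
      by (rule DERIV_image_chain[where g="\<lambda>s. r - s", unfolded comp_def])
         (auto intro!: derivative_eq_intros)
    then have "((\<lambda>s. - exp (- ?a * s) * w k (r - s)) has_real_derivative exp (- ?a * s) * (?S (r - s) - g)) (at s within {0..r})"
      by (auto intro!: derivative_eq_intros simp: algebra_simps)
    then show "((\<lambda>s. - exp (- ?a * s) * w k (r - s)) has_vector_derivative exp (- ?a * s) * (?S (r - s) - g)) (at s within {0..r})"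
      by (simp add: has_real_derivative_iff_has_vector_derivative)
  qed (use r' in simp)
  then have "((\<lambda>s. exp (- ?a * s) * (?S (r - s) - g)) has_integral (w k r - exp (- ?a * r) * w k 0)) {0<..<r}"
    by (simp add: has_integral_Icc_iff_Ioo)
  from has_integral_add[OF this has_integral_exp_decay[of r ?a g]]
  have "((\<lambda>s. exp (- ?a * s) * (rate M k * state_value M w (snd (s, k, SC, r - s))
       + uso_rate M * state_value M w (snd (s, k, USO, r - s)))) has_integral
      (w k r - exp (- ?a * r) * w k 0 + g * mean_sojourn_from k r)) {0<..<r}"
    using r' a by (simp add: algebra_simps mean_sojourn_from_def)
  from has_bochner_integral_sojourn_law[OF r _ _ this, of B]
  have "has_bochner_integral (sojourn_law M k r) (\<lambda>y. state_value M w (snd y))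
     (w k r - exp (- ?a * r) * w k 0 + g * mean_sojourn_from k r + exp (- ?a * r) * state_value M w (snd (r, k, SO, 0)))"
    using B by force
  then show ?thesis
    by (simp add: has_bochner_integral_iff w_0 del: state_value.simps)
qed

text \<open>The mean sojourn time enters \<open>continuation_value\<close> with exactly the factor \<open>g\<close> that the optimality
equation subtracts.\<close>

lemma optimality_rhs_state_value:
  assumes x: "x \<in> states M"
  shows "optimality_rhs M (state_value M w) g x a = cost M x a + (\<integral>k. w k (time_to_SO M x) \<partial>post_cond M x a)"
proof -
  obtain B where B: "\<And>x. x \<in> states M \<Longrightarrow> \<bar>state_value M w x\<bar> \<le> B"
    using abs_state_value_bound by blast
  have "(\<integral>y. state_value M w y \<partial>next_state_law M x a) =
      (\<integral>k. w k (time_to_SO M x) + g * mean_sojourn_from k (time_to_SO M x) \<partial>post_cond M x a)"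
    unfolding integral_next_state_law[OF measurable_state_value]
    using B by (subst integral_transition[OF x, where B=B])
      (auto simp: continuation_value[OF time_to_SO_horizon[OF x]])
  then show ?thesis
    by (simp add: optimality_rhs_def mean_sojourn_eq[OF x] integrable_measure_pmf_finite)
qed

lemma optimality_equation:
  assumes x: "x \<in> states M"
  shows "state_value M w x = Min (optimality_rhs M (state_value M w) g x ` admissible x)"
proof -
  have "(\<integral>k. w k r \<partial>map_pmf (\<lambda>success. if success then Perfect else i) (bernoulli_pmf (pm_success M)))
      = pm_success M * w Perfect r + (1 - pm_success M) * w i r" for i r
    using pm_success_pos pm_success_le_1 by (simp add: integral_map_pmf)
  moreover have "pm_success M * y + (1 - pm_success M) * y = y" for y
    by (simp add: algebra_simps)
  moreover obtain i j t where "x = (i, j, t)" by (cases x)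
  ultimately show ?thesis
    using optimality_rhs_state_value[OF x]
    by (cases i; cases j) simp_all
qed

text \<open>Comparing the right-hand sides of the two maintenance options defines a measurable selector, because
these right-hand sides depend measurably on the state.\<close>

lemma minimizing_policy_exists: "minimizing_policies M (state_value M w) g \<noteq> {}"
proof -
  let ?rhs = "optimality_rhs M (state_value M w) g"
  define \<pi> where "\<pi> x = (if fst (snd x) = SC then if fst x = Perfect then DoNothing else PerformCM
    else if ?rhs x PerformPM \<le> ?rhs x DoNothing then PerformPM else DoNothing)" for x
  have [measurable]: "(\<lambda>x. ?rhs x a) \<in> borel_measurable (state_space M)" for a
    by (rule measurable_optimality_rhs[where \<pi>="\<lambda>_. a"]) simp_all
  have "\<pi> \<in> state_space M \<rightarrow>\<^sub>M count_space UNIV"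
    unfolding \<pi>_def by measurable
  moreover have "\<pi> x \<in> admissible x \<and> ?rhs x (\<pi> x) = Min (?rhs x ` admissible x)" if "x \<in> states M" for x
  proof -
    obtain i j t where "x = (i, j, t)" by (cases x)
    then show ?thesis by (cases i; cases j) (simp_all add: \<pi>_def)
  qed
  ultimately have "\<pi> \<in> minimizing_policies M (state_value M w) g"
    by (simp add: minimizing_policies_def policies_def)
  then show ?thesis by blast
qed

lemma average_cost_ge:
  assumes "\<pi> \<in> policies M" "x \<in> states M"
  shows "ereal g \<le> ratio_average_cost M x \<pi>"
proof -
  interpret pm_system_policy M \<pi> x by unfold_locales (fact assms)+
  obtain B where B: "\<And>x. x \<in> states M \<Longrightarrow> \<bar>state_value M w x\<bar> \<le> B"
    using abs_state_value_bound by blast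
  show ?thesis
  proof (rule ratio_average_cost_ge[OF measurable_state_value B])
    fix y assume y: "y \<in> states M"
    then have "\<pi> y \<in> admissible y" using assms by (simp add: policies_def)
    moreover have "finite (admissible y)"
      by (rule finite_subset[OF _ finite_UNIV_action]) simp
    ultimately show "state_value M w y \<le> optimality_rhs M (state_value M w) g y (\<pi> y)"
      unfolding optimality_equation[OF y] by (intro Min_le) simp_all
  qed
qed

lemma average_cost_minimizing:
  assumes "\<pi> \<in> minimizing_policies M (state_value M w) g" "x \<in> states M"
  shows "ratio_average_cost M x \<pi> = ereal g"
proof -
  interpret pm_system_policy M \<pi> x
    by unfold_locales (use assms in \<open>simp_all add: minimizing_policies_def\<close>)
  obtain B where B: "\<And>x. x \<in> states M \<Longrightarrow> \<bar>state_value M w x\<bar> \<le> B"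
    using abs_state_value_bound by blast
  show ?thesis
    using assms(1) optimality_equation
    by (intro ratio_average_cost_eq[OF measurable_state_value B]) (simp_all add: minimizing_policies_def)
qed

lemma optimal_average_cost:
  assumes x: "x \<in> states M"
  shows "(INF \<pi>\<in>policies M. ratio_average_cost M x \<pi>) = ereal g"
proof (rule antisym)
  obtain \<pi> where \<pi>: "\<pi> \<in> minimizing_policies M (state_value M w) g"
    using minimizing_policy_exists by blast
  then have "\<pi> \<in> policies M" by (simp add: minimizing_policies_def)
  then show "(INF \<pi>\<in>policies M. ratio_average_cost M x \<pi>) \<le> ereal g"
    by (rule INF_lower2) (simp add: average_cost_minimizing[OF \<pi> x])
  show "ereal g \<le> (INF \<pi>\<in>policies M. ratio_average_cost M x \<pi>)"
    by (rule INF_greatest) (rule average_cost_ge[OF _ x])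
qed

end

theorem proposition3:
  fixes M :: pm_model
  assumes "\<And>i. 0 < rate M i" and "0 < uso_rate M" and "0 < period M"
    and "0 < pm_success M" and "pm_success M \<le> 1"
    and "0 < cost_pm_so M" and "cost_pm_so M < cost_cm M"
    and "0 < cost_pm_uso M" and "cost_pm_uso M < cost_cm M"
  shows "\<exists>(V :: state \<Rightarrow> real) (g :: real).
      V \<in> borel_measurable (state_space M) \<and> bounded (V ` states M) \<and>
      (\<forall>x\<in>states M. V x = Min (optimality_rhs M V g x ` admissible x)) \<and>
      minimizing_policies M V g \<noteq> {} \<and>
      (\<forall>\<pi>\<in>minimizing_policies M V g. \<forall>x\<in>states M.
         ratio_average_cost M x \<pi> = (INF \<pi>'\<in>policies M. ratio_average_cost M x \<pi>')) \<and>
      (\<forall>x\<in>states M. ereal g = (INF \<pi>\<in>policies M. ratio_average_cost M x \<pi>)) \<and>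
      (\<forall>\<pi>\<in>policies M. \<forall>x\<in>states M.
         ratio_average_cost M x \<pi> =
           limsup (\<lambda>n. ereal (expected_cost M \<pi> x n / expected_mean_sojourns M \<pi> x n)))"
proof -
  interpret pm_system M by unfold_locales (fact assms)+
  obtain w g where "solves_value_ode M w g"
    using exists_value_ode_solution by blast
  then interpret value_ode_solution M w g by unfold_locales
  have "ratio_average_cost M x \<pi> =
      limsup (\<lambda>n. ereal (expected_cost M \<pi> x n / expected_mean_sojourns M \<pi> x n))"
    if "\<pi> \<in> policies M" "x \<in> states M" for \<pi> x
  proof -
    interpret pm_system_policy M \<pi> x by unfold_locales (fact that)+
    show ?thesis by (simp add: ratio_average_cost_def expected_time_eq)
  qed
  then show ?thesis
    using measurable_state_value bounded_state_value optimality_equation minimizing_policy_exists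
      average_cost_minimizing optimal_average_cost
    by (intro exI[of _ "state_value M w"] exI[of _ g]) simp
qed

end
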